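(* Let $A \in \mathbb{C}_{\rm H}^{m}$ and $B \in \mathbb{C}^{m\times n}$ be given, and let $M=\begin{bmatrix} A & B\\ B^{*} & 0\end{bmatrix}$. Then the following hold. (a) There exists $X \in \mathbb{C}_{\rm H}^{n}$ such that $BXB^{*}\succcurlyeq A$ if and only if $E_BAE_B \preccurlyeq 0$ and $r(E_BAE_B)=r(E_BA)$, or equivalently, $i_{+}(M)=r(B)$ and $i_{-}(M)=r[\,A,\,B\,]$. In this case, the general Hermitian solution of $BXB^{*}\succcurlyeq A$ can be written as $$X = B^{\dagger}A(B^{\dagger})^{*} - B^{\dagger}AE_B(E_BAE_B)^{\dagger}E_BA(B^{\dagger})^{*} + UU^{*} + F_BV + V^{*}F_B, \qquad (\star)$$ and for such $X$ $$BXB^{*} = A - AE_B(E_BAE_B)^{\dagger}E_BA + BUU^{*}B^{*},\qquad A - BXB^{*} = AE_B(E_BAE_B)^{\dagger}E_BA - BUU^{*}B^{*},$$ where $U, V\in\mathbb{C}^{n\times n}$ are arbitrary. (b) There exists $X \in \mathbb{C}_{\rm H}^{n}$ such that $BXB^{*}\succ A$ if and only if $E_BAE_B\preccurlyeq 0$ and $r(E_BAE_B)=r(E_B)$. In this case, the general Hermitian solution of $BXB^{*}\succ A$ can be written as $(\star)$, in which $U\in\mathbb{C}^{n\times n}$ is a matrix such that $r[\,AE_B(E_BAE_B)^{\dagger}E_BA - BUU^{*}B^{*}\,]=m$, and $V\in\mathbb{C}^{n\times n}$ is arbitrary. In particular: (c) If the equation $BXB^{*}=A$ is consistent, then the general Hermitian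 solution of $BXB^{*}\succcurlyeq A$ can be written as $X = B^{\dagger}A(B^{\dagger})^{*} + UU^{*} + F_BV + V^{*}F_B$, where $U,V\in\mathbb{C}^{n\times n}$ are arbitrary. (d) If the equation $BXB^{*}=A$ is consistent, then $BXB^{*}\succ A$ has a Hermitian solution if and only if $r(B)=m$, in which case the general Hermitian solution can be written as $X = B^{\dagger}A(B^{\dagger})^{*} + U + F_BV + V^{*}F_B$, where $U\in\mathbb{C}_{\rm H}^{n}$ is an arbitrary matrix such that $BUB^{*}\succ 0$, and $V\in\mathbb{C}^{n\times n}$ is arbitrary.
   Context: $\mathbb{C}_{\rm H}^{m}$ is the set of $m\times m$ complex Hermitian matrices. $r(\cdot)$ is rank; $A^{*}$ is the conjugate transpose; $A^{\dagger}$ is the Moore--Penrose inverse. For $B\in\mathbb{C}^{m\times n}$, $E_B=I_m-BB^{\dagger}$ and $F_B=I_n-B^{\dagger}B$. $i_{+}(A)$ and $i_{-}(A)$ are the numbers of positive and negative eigenvalues of a Hermitian matrix $A$, counted with multiplicity. $[\,A,\,B\,]$ is the row block matrix. For Hermitian $P,Q$, $P\succcurlyeq Q$ ($P\succ Q$) means $P-Q$ is positive semi-definite (positive definite), and $P\preccurlyeq Q$ means $Q\succcurlyeq P$. "The general Hermitian solution can be written as ..." means that the set of all Hermitian solutions is exactly the set of matrices of the given form as the parameters range over the indicated sets. "$BXB^*=A$ is consistent" means it has a Hermitian solution $X$. *)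

theory Defs
  imports
    "Jordan_Normal_Form.Schur_Decomposition"
    "Jordan_Normal_Form.DL_Rank"
begin

notation mat_adjoint ("(_\<^sup>H)" [1000] 1000)

definition hermitian_mats :: "nat \<Rightarrow> complex mat set" where
  "hermitian_mats m = {A \<in> carrier_mat m m. A\<^sup>H = A}"

abbreviation mrank :: "complex mat \<Rightarrow> nat" where
  "mrank A \<equiv> vec_space.rank (dim_row A) A"

definition row_block :: "complex mat \<Rightarrow> complex mat \<Rightarrow> complex mat" where
  "row_block A B = mat_of_cols (dim_row A) (cols A @ cols B)"

text \<open>The Moore--Penrose inverse, i.e. the unique solution of the four Penrose equations.\<close>

definition is_mp_inverse :: "complex mat \<Rightarrow> complex mat \<Rightarrow> bool" where
  "is_mp_inverse A X \<longleftrightarrow>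
     X \<in> carrier_mat (dim_col A) (dim_row A) \<and>
     A * X * A = A \<and> X * A * X = X \<and> (A * X)\<^sup>H = A * X \<and> (X * A)\<^sup>H = X * A"

definition mp_inverse :: "complex mat \<Rightarrow> complex mat" ("(_\<^sup>\<dagger>)" [1000] 1000) where
  "A\<^sup>\<dagger> = (THE X. is_mp_inverse A X)"

definition E_proj :: "complex mat \<Rightarrow> complex mat" where
  "E_proj B = 1\<^sub>m (dim_row B) - B * B\<^sup>\<dagger>"

definition F_proj :: "complex mat \<Rightarrow> complex mat" where
  "F_proj B = 1\<^sub>m (dim_col B) - B\<^sup>\<dagger> * B"

text \<open>Numbers of positive and negative eigenvalues, counted with multiplicity as roots of the
  characteristic polynomial. Summing over real eigenvalues loses nothing for the Hermitian
  matrices these functions are meant for.\<close>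

definition i_plus :: "complex mat \<Rightarrow> nat" where
  "i_plus A = (\<Sum>x | 0 < x \<and> eigenvalue A (complex_of_real x).
                 Polynomial.order (complex_of_real x) (char_poly A))"

definition i_minus :: "complex mat \<Rightarrow> nat" where
  "i_minus A = (\<Sum>x | x < 0 \<and> eigenvalue A (complex_of_real x).
                  Polynomial.order (complex_of_real x) (char_poly A))"

text \<open>\<open>(A *\<^sub>v v) \<bullet>c v\<close> is $v^* A v$; an inequality between it and 0 in the order on
  complex numbers includes that its imaginary part is 0.\<close>

definition pos_semidef :: "complex mat \<Rightarrow> bool" where
  "pos_semidef A \<longleftrightarrow> A \<in> hermitian_mats (dim_row A) \<and>
     (\<forall>v \<in> carrier_vec (dim_row A). 0 \<le> (A *\<^sub>v v) \<bullet>c v)"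

definition pos_def :: "complex mat \<Rightarrow> bool" where
  "pos_def A \<longleftrightarrow> A \<in> hermitian_mats (dim_row A) \<and>
     (\<forall>v \<in> carrier_vec (dim_row A). v \<noteq> 0\<^sub>v (dim_row A) \<longrightarrow> 0 < (A *\<^sub>v v) \<bullet>c v)"

definition loewner_ge :: "complex mat \<Rightarrow> complex mat \<Rightarrow> bool" (infix "\<succeq>\<^sub>L" 50) where
  "P \<succeq>\<^sub>L Q \<longleftrightarrow> pos_semidef (P - Q)"

definition loewner_gt :: "complex mat \<Rightarrow> complex mat \<Rightarrow> bool" (infix "\<succ>\<^sub>L" 50) where
  "P \<succ>\<^sub>L Q \<longleftrightarrow> pos_def (P - Q)"

abbreviation loewner_le :: "complex mat \<Rightarrow> complex mat \<Rightarrow> bool" (infix "\<preceq>\<^sub>L" 50) where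
  "P \<preceq>\<^sub>L Q \<equiv> Q \<succeq>\<^sub>L P"

text \<open>The parametrised family $(\star)$.\<close>

definition star_solution ::
    "complex mat \<Rightarrow> complex mat \<Rightarrow> complex mat \<Rightarrow> complex mat \<Rightarrow> complex mat" where
  "star_solution A B U V =
     B\<^sup>\<dagger> * A * (B\<^sup>\<dagger>)\<^sup>H
     - B\<^sup>\<dagger> * A * E_proj B * (E_proj B * A * E_proj B)\<^sup>\<dagger> * E_proj B * A * (B\<^sup>\<dagger>)\<^sup>H
     + U * U\<^sup>H + F_proj B * V + V\<^sup>H * F_proj B"

end

theory Submission
  imports Defs "Jordan_Normal_Form.Spectral_Radius"
begin

text \<open>
  Write \<open>E = I - B B\<^sup>\<dagger>\<close> and \<open>N = E A E\<close>. Since \<open>E B = 0\<close>, the residual \<open>P = B X B\<^sup>H - A\<close> satisfies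
  \<open>E P = - E A\<close> and \<open>E P E = - N\<close> for every \<open>X\<close>. If \<open>P\<close> is positive semidefinite, then so is
  \<open>- N\<close>, and the column space of \<open>E P\<close> is contained in that of \<open>E P E\<close>; the latter is the condition
  \<open>r(N) = r(E A)\<close>. Moreover the Schur complement of \<open>E P E\<close> in \<open>P\<close> is again positive semidefinite
  (\<open>psd_schur_complement\<close>), and it equals \<open>B X B\<^sup>H - S\<close> with \<open>S = A - A E N\<^sup>\<dagger> E A\<close>.

  Conversely, let \<open>- N\<close> be positive semidefinite and \<open>r(N) = r(E A)\<close>. Then \<open>E S = 0\<close>, so
  \<open>S = B X\<^sub>0 B\<^sup>H\<close> with \<open>X\<^sub>0 = B\<^sup>\<dagger> S (B\<^sup>\<dagger>)\<^sup>H\<close>, and \<open>S - A\<close> is positive semidefinite. Hence the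
  inequality \<open>B X B\<^sup>H \<succeq> A\<close> says the same as \<open>B (X - X\<^sub>0) B\<^sup>H \<succeq> 0\<close>, and the hermitian \<open>Y\<close> with
  \<open>B Y B\<^sup>H \<succeq> 0\<close> are exactly the \<open>U U\<^sup>H + F V + V\<^sup>H F\<close> with \<open>F = I - B\<^sup>\<dagger> B\<close> (\<open>general_form\<close>): a Gram
  matrix plus a hermitian matrix whose quadratic form vanishes on the range of \<open>B\<^sup>H\<close>. A positive semidefinite
  matrix is positive definite iff it has full rank, which gives the strict version.

  The inertia criterion follows from \<open>i\<^sub>\<plusminus>(M) = r(B) + i\<^sub>\<plusminus>(N)\<close> (\<open>i_plus_bordered\<close>) and
  \<open>r[A, B] = r(B) + r(E A)\<close> (\<open>mrank_row_block\<close>).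

  Two devices keep dimension counts out of these arguments. The rank of \<open>A\<close> is the trace of the
  orthogonal projection \<open>A A\<^sup>\<dagger>\<close> (\<open>mrank_mp\<close>), so an equation between ranks of nested column spaces
  becomes an equation between projections (\<open>column_space_rank\<close>). And the positive index of \<open>H\<close> is
  found by exhibiting a splitting \<open>H = P P\<^sup>H - G G\<^sup>H\<close>, which bounds it by the rank of \<open>P\<close>, and a
  matrix \<open>Q\<close> with \<open>Q\<^sup>H H Q\<close> positive semidefinite, where the rank of \<open>Q\<^sup>H H Q\<close> bounds it from below
  (\<open>i_plus_eqI\<close>).
\<close>

section \<open>Matrix algebra\<close>

text \<open>These rules are conditional on equations between dimensions instead of membership in a set
  of matrices of fixed size, so the simplifier can discharge the conditions for compound terms.\<close>

named_theorems mat_simps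

lemma mult_assoc_dim [mat_simps]:
  fixes A B C :: "'a::semiring_0 mat"
  assumes "dim_col A = dim_row B" "dim_col B = dim_row C"
  shows "A * B * C = A * (B * C)"
  by (rule assoc_mult_mat[of A "dim_row A" "dim_row B" B "dim_row C" C "dim_col C"])
     (use assms in auto)

lemma mult_add_distrib_dim [mat_simps]:
  fixes A B C :: "'a::semiring_0 mat"
  assumes "dim_col A = dim_row B" "dim_row C = dim_row B" "dim_col C = dim_col B"
  shows "A * (B + C) = A * B + A * C"
  by (rule mult_add_distrib_mat[of A "dim_row A" "dim_row B" B "dim_col B"])
     (use assms in auto)

lemma add_mult_distrib_dim [mat_simps]:
  fixes A B C :: "'a::semiring_0 mat"
  assumes "dim_col A = dim_row C" "dim_row B = dim_row A" "dim_col B = dim_col A"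
  shows "(A + B) * C = A * C + B * C"
  by (rule add_mult_distrib_mat[of A "dim_row A" "dim_col A" B C "dim_col C"])
     (use assms in auto)

lemma mult_minus_distrib_dim [mat_simps]:
  fixes A B C :: "'a::ring mat"
  assumes "dim_col A = dim_row B" "dim_row C = dim_row B" "dim_col C = dim_col B"
  shows "A * (B - C) = A * B - A * C"
  by (rule mult_minus_distrib_mat[of A "dim_row A" "dim_row B" B "dim_col B"])
     (use assms in auto)

lemma minus_mult_distrib_dim [mat_simps]:
  fixes A B C :: "'a::ring mat"
  assumes "dim_col A = dim_row C" "dim_row B = dim_row A" "dim_col B = dim_col A"
  shows "(A - B) * C = A * C - B * C"
  by (rule minus_mult_distrib_mat[of A "dim_row A" "dim_col A" B C "dim_col C"])
     (use assms in auto)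

lemma uminus_mult_dim [mat_simps]:
  fixes A B :: "'a::ring mat"
  assumes "dim_col A = dim_row B"
  shows "- A * B = - (A * B)" "A * - B = - (A * B)"
  using assms by auto

lemma one_mult_dim [mat_simps]:
  fixes A :: "'a::semiring_1 mat"
  shows "dim_row A = n \<Longrightarrow> 1\<^sub>m n * A = A" "dim_col A = n \<Longrightarrow> A * 1\<^sub>m n = A"
  by auto

lemma zero_mult_dim [mat_simps]:
  fixes A :: "'a::semiring_0 mat"
  shows "dim_row A = n \<Longrightarrow> 0\<^sub>m k n * A = 0\<^sub>m k (dim_col A)"
    "dim_col A = n \<Longrightarrow> A * 0\<^sub>m n k = 0\<^sub>m (dim_row A) k"
  by auto

lemma add_zero_dim [mat_simps]:
  fixes A :: "'a::group_add mat"
  assumes "dim_row A = n" "dim_col A = k"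
  shows "0\<^sub>m n k + A = A" "A + 0\<^sub>m n k = A" "A - 0\<^sub>m n k = A" "0\<^sub>m n k - A = - A"
  using assms by (auto intro!: eq_matI)

text \<open>Products are normalised to the right, so a relation between two factors has to be
  available also in front of a further factor.\<close>

lemma mult_chain:
  fixes A B C X :: "'a::semiring_0 mat"
  assumes "A * B = C" "dim_col A = dim_row B" "dim_col B = dim_row X"
  shows "A * (B * X) = C * X"
  using assms mult_assoc_dim by metis

lemma minus_eq_zero_mat_iff:
  fixes A B :: "'a::group_add mat"
  assumes "A \<in> carrier_mat n k" "B \<in> carrier_mat n k"
  shows "A - B = 0\<^sub>m n k \<longleftrightarrow> A = B"
proof
  assume *: "A - B = 0\<^sub>m n k"
  show "A = B"
  proof (rule eq_matI)
    fix i j assume "i < dim_row B" "j < dim_col B"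
    then show "A $$ (i,j) = B $$ (i,j)"
      using arg_cong[OF *, of "\<lambda>M. M $$ (i,j)"] assms by auto
  qed (use assms in auto)
qed (use assms in \<open>auto intro!: eq_matI\<close>)

subsection \<open>Conjugate transpose\<close>

lemma dim_adjoint [simp]: "dim_row A\<^sup>H = dim_col A" "dim_col A\<^sup>H = dim_row A"
  by (auto simp: mat_adjoint_def)

lemma adjoint_carrier [simp]: "A \<in> carrier_mat n k \<Longrightarrow> A\<^sup>H \<in> carrier_mat k n"
  by auto

lemma adjoint_index [simp]:
  "i < dim_col A \<Longrightarrow> j < dim_row A \<Longrightarrow> A\<^sup>H $$ (i,j) = conjugate (A $$ (j,i))"
  by (auto simp: mat_adjoint_def mat_of_rows_def)

lemma adjoint_adjoint [simp]: "(A\<^sup>H)\<^sup>H = A"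
  by (rule eq_matI) auto

lemma adjoint_mult [mat_simps]:
  "dim_col A = dim_row B \<Longrightarrow> (A * B)\<^sup>H = B\<^sup>H * A\<^sup>H"
  by (rule eq_matI)
    (auto simp: scalar_prod_def sum_conjugate conjugate_dist_mul mult.commute)

lemma adjoint_add [mat_simps]:
  "dim_row A = dim_row B \<Longrightarrow> dim_col A = dim_col B \<Longrightarrow> (A + B)\<^sup>H = A\<^sup>H + B\<^sup>H"
  by (rule eq_matI) (auto simp: conjugate_dist_add)

lemma adjoint_minus [mat_simps]:
  fixes A B :: "complex mat"
  shows "dim_row A = dim_row B \<Longrightarrow> dim_col A = dim_col B \<Longrightarrow> (A - B)\<^sup>H = A\<^sup>H - B\<^sup>H"
  by (rule eq_matI) auto

lemma adjoint_uminus [mat_simps]: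
  fixes A :: "complex mat"
  shows "(- A)\<^sup>H = - A\<^sup>H"
  by (rule eq_matI) auto

lemma adjoint_one [mat_simps]: "(1\<^sub>m n :: complex mat)\<^sup>H = 1\<^sub>m n"
  by (rule eq_matI) auto

lemma adjoint_zero [mat_simps]: "(0\<^sub>m n k :: complex mat)\<^sup>H = 0\<^sub>m k n"
  by (rule eq_matI) auto

lemma adjoint_smult [mat_simps]: "(c \<cdot>\<^sub>m A :: complex mat)\<^sup>H = cnj c \<cdot>\<^sub>m A\<^sup>H"
  by (rule eq_matI) auto

lemma adjoint_four_block [mat_simps]:
  fixes A B C D :: "complex mat"
  assumes "dim_row B = dim_row A" "dim_col C = dim_col A" "dim_row D = dim_row C"
    "dim_col D = dim_col B"
  shows "(four_block_mat A B C D)\<^sup>H = four_block_mat A\<^sup>H C\<^sup>H B\<^sup>H D\<^sup>H"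
  by (rule eq_matI) (use assms in auto)

lemma scalar_prod_adjoint:
  fixes A :: "complex mat"
  assumes "A \<in> carrier_mat n k" "v \<in> carrier_vec k" "w \<in> carrier_vec n"
  shows "(A *\<^sub>v v) \<bullet>c w = v \<bullet>c (A\<^sup>H *\<^sub>v w)"
proof -
  have "(A *\<^sub>v v) \<bullet>c w = (\<Sum>i<n. \<Sum>j<k. A $$ (i,j) * v $ j * cnj (w $ i))"
    using assms by (auto simp: scalar_prod_def atLeast0LessThan sum_distrib_right intro!: sum.cong)
  also have "\<dots> = (\<Sum>j<k. \<Sum>i<n. A $$ (i,j) * v $ j * cnj (w $ i))"
    by (rule sum.swap)
  also have "\<dots> = v \<bullet>c (A\<^sup>H *\<^sub>v w)"
    using assms by (auto simp: scalar_prod_def atLeast0LessThan sum_distrib_left intro!: sum.cong)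
  finally show ?thesis .
qed

text \<open>The diagonal entries of a Gram matrix are the squared norms of the columns of its factor,
  so they cannot cancel in a sum.\<close>

lemma gram_sum_eq_zero:
  fixes X Y :: "complex mat"
  assumes X: "X \<in> carrier_mat n k" and Y: "Y \<in> carrier_mat l k"
    and z: "X\<^sup>H * X + Y\<^sup>H * Y = 0\<^sub>m k k"
  shows "X = 0\<^sub>m n k"
proof (rule eq_matI)
  fix i j assume ij: "i < dim_row (0\<^sub>m n k)" "j < dim_col (0\<^sub>m n k)"
  have sq: "cnj z * z = of_real ((cmod z)\<^sup>2)" for z
    using complex_norm_square[of z] by (simp add: mult.commute)
  have "0 = (X\<^sup>H * X + Y\<^sup>H * Y) $$ (j,j)"
    using z ij by simp
  also have "\<dots> = of_real ((\<Sum>i<n. (cmod (X $$ (i,j)))\<^sup>2) + (\<Sum>i<l. (cmod (Y $$ (i,j)))\<^sup>2))"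
    using X Y ij by (auto simp: scalar_prod_def sq atLeast0LessThan simp flip: of_real_power)
  finally have "0 = complex_of_real ((\<Sum>i<n. (cmod (X $$ (i,j)))\<^sup>2) + (\<Sum>i<l. (cmod (Y $$ (i,j)))\<^sup>2))" .
  from this[symmetric] have "(\<Sum>i<n. (cmod (X $$ (i,j)))\<^sup>2) + (\<Sum>i<l. (cmod (Y $$ (i,j)))\<^sup>2) = 0"
    by (rule iffD1[OF of_real_eq_0_iff])
  then have "(\<Sum>i<n. (cmod (X $$ (i,j)))\<^sup>2) = 0"
    by (simp add: add_nonneg_eq_0_iff sum_nonneg)
  then show "X $$ (i,j) = 0\<^sub>m n k $$ (i,j)"
    using ij by (simp add: sum_nonneg_eq_0_iff)
qed (use X in auto)

lemma gram_eq_zero: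
  fixes X :: "complex mat"
  assumes "X \<in> carrier_mat n k" "X\<^sup>H * X = 0\<^sub>m k k"
  shows "X = 0\<^sub>m n k"
  by (rule gram_sum_eq_zero[OF assms(1) zero_carrier_mat[of 0 k]]) (use assms in \<open>auto simp: mat_simps\<close>)

text \<open>Multiplying by \<open>Z\<^sup>H\<close> from the left turns the hypothesis into a vanishing Gram matrix of
  \<open>Q Z\<close>. This is how kernel inclusions are proved below without mentioning vectors.\<close>

lemma gram_cancel:
  fixes Q Z :: "complex mat"
  assumes "Q \<in> carrier_mat n k" "Z \<in> carrier_mat k l" "Q\<^sup>H * (Q * Z) = 0\<^sub>m k l"
  shows "Q * Z = 0\<^sub>m n l"
  by (rule gram_eq_zero) (use assms in \<open>auto simp: mat_simps\<close>)

subsection \<open>Trace\<close>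

definition mat_trace :: "complex mat \<Rightarrow> complex" where
  "mat_trace A = (\<Sum>i<dim_row A. A $$ (i,i))"

lemma mat_trace_comm:
  assumes "A \<in> carrier_mat n k" "B \<in> carrier_mat k n"
  shows "mat_trace (A * B) = mat_trace (B * A)"
proof -
  have "mat_trace (A * B) = (\<Sum>i<n. \<Sum>j<k. A $$ (i,j) * B $$ (j,i))"
    using assms by (auto simp: mat_trace_def scalar_prod_def atLeast0LessThan intro!: sum.cong)
  also have "\<dots> = (\<Sum>j<k. \<Sum>i<n. A $$ (i,j) * B $$ (j,i))"
    by (rule sum.swap)
  also have "\<dots> = mat_trace (B * A)"
    using assms
    by (auto simp: mat_trace_def scalar_prod_def atLeast0LessThan mult.commute intro!: sum.cong)
  finally show ?thesis .
qed

lemma mat_trace_add: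
  "A \<in> carrier_mat n n \<Longrightarrow> B \<in> carrier_mat n n \<Longrightarrow> mat_trace (A + B) = mat_trace A + mat_trace B"
  by (auto simp: mat_trace_def sum.distrib)

lemma mat_trace_minus:
  "A \<in> carrier_mat n n \<Longrightarrow> B \<in> carrier_mat n n \<Longrightarrow> mat_trace (A - B) = mat_trace A - mat_trace B"
  by (auto simp: mat_trace_def sum_subtractf)

lemma mat_trace_one [simp]: "mat_trace (1\<^sub>m n) = of_nat n"
  by (auto simp: mat_trace_def)

lemma mat_trace_block_diag:
  assumes "A \<in> carrier_mat n n" "D \<in> carrier_mat k k"
  shows "mat_trace (four_block_mat A (0\<^sub>m n k) (0\<^sub>m k n) D) = mat_trace A + mat_trace D"
proof -
  have "mat_trace (four_block_mat A (0\<^sub>m n k) (0\<^sub>m k n) D)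
      = (\<Sum>i<n + k. if i < n then A $$ (i,i) else D $$ (i - n, i - n))"
    using assms by (auto simp: mat_trace_def intro!: sum.cong)
  also have "\<dots> = (\<Sum>i<n. A $$ (i,i)) + (\<Sum>i<k. D $$ (i,i))"
    by (induction k) (auto simp: sum.lessThan_Suc)
  finally show ?thesis using assms by (simp add: mat_trace_def)
qed

text \<open>The trace of \<open>X\<^sup>H X\<close> is the sum of all \<open>|x\<^sub>i\<^sub>j|\<^sup>2\<close>.\<close>

lemma mat_trace_gram_eq_zero:
  fixes X :: "complex mat"
  assumes X: "X \<in> carrier_mat n k" and z: "mat_trace (X\<^sup>H * X) = 0"
  shows "X = 0\<^sub>m n k"
proof (rule eq_matI)
  fix i j assume ij: "i < dim_row (0\<^sub>m n k)" "j < dim_col (0\<^sub>m n k)"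
  have sq: "cnj z * z = of_real ((cmod z)\<^sup>2)" for z
    using complex_norm_square[of z] by (simp add: mult.commute)
  have "(0 :: complex) = of_real (\<Sum>j<k. \<Sum>i<n. (cmod (X $$ (i,j)))\<^sup>2)"
    using X z by (simp add: mat_trace_def scalar_prod_def sq atLeast0LessThan)
  from this[symmetric] have "(\<Sum>j<k. \<Sum>i<n. (cmod (X $$ (i,j)))\<^sup>2) = 0"
    by (rule iffD1[OF of_real_eq_0_iff])
  then have "(\<Sum>i<n. (cmod (X $$ (i,j)))\<^sup>2) = 0"
    using ij by (simp add: sum_nonneg_eq_0_iff sum_nonneg)
  then show "X $$ (i,j) = 0\<^sub>m n k $$ (i,j)"
    using ij by (simp add: sum_nonneg_eq_0_iff)
qed (use X in auto)

section \<open>The spectral theorem\<close>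

definition unitary_mat :: "nat \<Rightarrow> complex mat \<Rightarrow> bool" where
  "unitary_mat n U \<longleftrightarrow> U \<in> carrier_mat n n \<and> U\<^sup>H * U = 1\<^sub>m n \<and> U * U\<^sup>H = 1\<^sub>m n"

definition real_diag :: "nat \<Rightarrow> (nat \<Rightarrow> real) \<Rightarrow> complex mat" where
  "real_diag n d = mat_diag n (\<lambda>i. of_real (d i))"

lemma real_diag_dim [simp]: "dim_row (real_diag n d) = n" "dim_col (real_diag n d) = n"
  "real_diag n d \<in> carrier_mat n n"
  by (auto simp: real_diag_def mat_diag_def)

lemma real_diag_index [simp]:
  "i < n \<Longrightarrow> j < n \<Longrightarrow> real_diag n d $$ (i,j) = (if i = j then of_real (d j) else 0)"
  by (auto simp: real_diag_def mat_diag_def)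

lemma real_diag_mult [mat_simps]: "real_diag n d * real_diag n e = real_diag n (\<lambda>i. d i * e i)"
  by (simp add: real_diag_def)

lemma real_diag_adjoint [mat_simps]: "(real_diag n d)\<^sup>H = real_diag n d"
  by (rule eq_matI) auto

text \<open>Complete \<open>v\<close> to a basis, orthogonalise it starting with \<open>v\<close>, and normalise.\<close>

lemma unitary_first_column:
  assumes v: "v \<in> carrier_vec n" and v0: "v \<noteq> 0\<^sub>v n"
  shows "\<exists>W c. unitary_mat n W \<and> c \<noteq> 0 \<and> col W 0 = c \<cdot>\<^sub>v v"
proof -
  interpret cof_vec_space n "TYPE(complex)" .
  have n: "n > 0"
    using v v0 by (cases n) auto
  define b where "b = basis_completion v"
  define ws where "ws = gram_schmidt n b"
  from basis_completion[OF v v0, folded b_def]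
  have b: "distinct b" "\<not> lin_dep (set b)" "set b \<subseteq> carrier_vec n" "hd b = v" "length b = n"
    by auto
  obtain vs where bv: "b = v # vs" using b n by (cases b) auto
  from gram_schmidt_result[OF b(3,1,2) refl, folded ws_def] b(5)
  have ws: "set ws \<subseteq> carrier_vec n" "corthogonal ws" "length ws = n" by auto
  have hdws: "hd ws = v"
    unfolding ws_def bv using gram_schmidt_hd[OF v] .
  \<comment> \<open>The inverse norm of the i-th vector of the orthogonal basis.\<close>
  define r where "r i = complex_of_real (1 / sqrt (Re (ws ! i \<bullet>c ws ! i)))" for i
  define W where "W = mat_of_cols n (map (\<lambda>i. r i \<cdot>\<^sub>v ws ! i) [0..<n])"
  have W: "W \<in> carrier_mat n n" by (rule carrier_matI) (simp_all add: W_def)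
  have wsi: "ws ! i \<in> carrier_vec n" if "i < n" for i
    using ws that by auto
  have colW: "col W i = r i \<cdot>\<^sub>v ws ! i" if "i < n" for i
    unfolding W_def using that wsi by (subst col_mat_of_cols) auto
  have norm_pos: "ws ! i \<bullet>c ws ! i = of_real (Re (ws ! i \<bullet>c ws ! i))" "0 < Re (ws ! i \<bullet>c ws ! i)"
    if "i < n" for i
  proof -
    have "ws ! i \<bullet>c ws ! i \<noteq> 0" using corthogonalD[OF ws(2), of i i] that ws(3) by auto
    moreover have "0 \<le> ws ! i \<bullet>c ws ! i" by (rule conjugate_square_ge_0_vec)
    ultimately show "ws ! i \<bullet>c ws ! i = of_real (Re (ws ! i \<bullet>c ws ! i))" "0 < Re (ws ! i \<bullet>c ws ! i)"
      by (auto simp: less_eq_complex_def complex_eq_iff)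
  qed
  have r0: "r i \<noteq> 0" if "i < n" for i
    using norm_pos(2)[OF that] by (simp add: r_def)
  have WW: "W\<^sup>H * W = 1\<^sub>m n"
  proof (rule eq_matI)
    fix i j assume "i < dim_row (1\<^sub>m n)" "j < dim_col (1\<^sub>m n)"
    then have ij: "i < n" "j < n" by auto
    have "(W\<^sup>H * W) $$ (i,j) = col W j \<bullet>c col W i"
      using W ij by (auto simp: scalar_prod_def mult.commute intro!: sum.cong)
    also have "\<dots> = r j * r i * (ws ! j \<bullet>c ws ! i)"
      using ij wsi[OF ij(1)] wsi[OF ij(2)]
      by (simp add: colW conjugate_smult_vec r_def)
    also have "\<dots> = 1\<^sub>m n $$ (i,j)"
    proof (cases "i = j")
      case True
      define s where "s = Re (ws ! i \<bullet>c ws ! i)"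
      have s: "s > 0" "ws ! i \<bullet>c ws ! i = of_real s"
        using norm_pos[OF ij(1)] by (auto simp: s_def)
      have "r i * r i * of_real s = of_real (1 / sqrt s * (1 / sqrt s) * s)"
        unfolding r_def s_def of_real_mult ..
      also have "1 / sqrt s * (1 / sqrt s) * s = 1"
        using s by (simp add: field_simps)
      finally show ?thesis using True ij s(2) by simp
    next
      case False
      then show ?thesis using corthogonalD[OF ws(2), of j i] ij ws(3) by auto
    qed
    finally show "(W\<^sup>H * W) $$ (i,j) = 1\<^sub>m n $$ (i,j)" .
  qed (use W in auto)
  have "W * W\<^sup>H = 1\<^sub>m n"
    using mat_mult_left_right_inverse[OF _ W WW] W by auto
  then have "unitary_mat n W" using W WW by (simp add: unitary_mat_def)
  moreover have "ws ! 0 = v" using hdws ws(3) n by (metis hd_conv_nth length_0_conv not_less0)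
  ultimately show ?thesis using colW[OF n] r0[OF n] by metis
qed

lemma unitary_mult:
  assumes "unitary_mat n U" "unitary_mat n V"
  shows "unitary_mat n (U * V)"
proof -
  have *: "U\<^sup>H * U = 1\<^sub>m n" "U * U\<^sup>H = 1\<^sub>m n" "V\<^sup>H * V = 1\<^sub>m n" "V * V\<^sup>H = 1\<^sub>m n"
    "U \<in> carrier_mat n n" "V \<in> carrier_mat n n"
    using assms by (auto simp: unitary_mat_def)
  note d = carrier_matD[OF *(5)] carrier_matD[OF *(6)]
  show ?thesis
    using *(1-4) d *(5,6)
    by (simp add: unitary_mat_def mat_simps d mult_chain[OF *(1)] mult_chain[OF *(4)])
qed

lemma mult_four_block_dim [mat_simps]:
  fixes A1 B1 C1 D1 :: "'a::semiring_0 mat"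
  assumes "dim_row B1 = dim_row A1" "dim_col C1 = dim_col A1" "dim_row D1 = dim_row C1"
    "dim_col D1 = dim_col B1"
    "dim_row A2 = dim_col A1" "dim_row B2 = dim_row A2" "dim_col C2 = dim_col A2"
    "dim_row C2 = dim_col B1" "dim_row D2 = dim_row C2" "dim_col D2 = dim_col B2"
  shows "four_block_mat A1 B1 C1 D1 * four_block_mat A2 B2 C2 D2
    = four_block_mat (A1 * A2 + B1 * C2) (A1 * B2 + B1 * D2) (C1 * A2 + D1 * C2) (C1 * B2 + D1 * D2)"
  by (rule mult_four_block_mat[of A1 "dim_row A1" "dim_col A1" B1 "dim_col B1" C1 "dim_row C1"])
     (use assms in auto)

text \<open>A unit eigenvector, extended to an orthonormal basis, splits off a one-dimensional
  block: in that basis the rest of the first column vanishes, and by hermitian symmetry so does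
  the rest of the first row. The remaining block is hermitian of smaller size.\<close>

theorem spectral_decomposition:
  assumes "H \<in> hermitian_mats n"
  shows "\<exists>U d. unitary_mat n U \<and> H = U * real_diag n d * U\<^sup>H"
  using assms
proof (induction n arbitrary: H)
  case 0
  then have "unitary_mat 0 (1\<^sub>m 0) \<and> H = 1\<^sub>m 0 * real_diag 0 (\<lambda>_. 0) * (1\<^sub>m 0)\<^sup>H"
    by (auto simp: unitary_mat_def hermitian_mats_def intro!: eq_matI)
  then show ?case by blast
next
  case (Suc n)
  have H: "H \<in> carrier_mat (Suc n) (Suc n)" "H\<^sup>H = H"
    using Suc.prems by (auto simp: hermitian_mats_def)
  obtain e where "eigenvalue H e"
    using spectrum_non_empty[OF H(1)] by (auto simp: spectrum_def)
  then obtain v where v: "v \<in> carrier_vec (Suc n)" "v \<noteq> 0\<^sub>v (Suc n)" "H *\<^sub>v v = e \<cdot>\<^sub>v v"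
    using H by (auto simp: eigenvalue_def eigenvector_def)
  obtain W c where W: "unitary_mat (Suc n) W" and c: "c \<noteq> 0" "col W 0 = c \<cdot>\<^sub>v v"
    using unitary_first_column[OF v(1,2)] by blast
  have WC: "W \<in> carrier_mat (Suc n) (Suc n)" "W\<^sup>H * W = 1\<^sub>m (Suc n)" "W * W\<^sup>H = 1\<^sub>m (Suc n)"
    using W by (auto simp: unitary_mat_def)
  define G where "G = W\<^sup>H * (H * W)"
  have G: "G \<in> carrier_mat (Suc n) (Suc n)" using WC H by (intro carrier_matI) (simp_all add: G_def)
  have GH: "G\<^sup>H = G" using WC H by (auto simp: G_def mat_simps)
  have HW: "H = W * G * W\<^sup>H"
    using H(1) WC by (simp add: G_def mat_simps mult_chain[OF WC(3)])
  have WA: "W\<^sup>H \<in> carrier_mat (Suc n) (Suc n)" and c0: "col W 0 \<in> carrier_vec (Suc n)"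
    using WC(1) by (simp_all add: carrier_vecI)
  have "col (H * W) 0 = H *\<^sub>v (c \<cdot>\<^sub>v v)"
    using col_mult2[OF H(1) WC(1), of 0] c(2) by simp
  also have "\<dots> = e \<cdot>\<^sub>v col W 0"
    unfolding c(2) mult_mat_vec[OF H(1) v(1)] v(3) by (simp add: smult_smult_assoc mult.commute)
  finally have "col (H * W) 0 = e \<cdot>\<^sub>v col W 0" .
  then have "col G 0 = W\<^sup>H *\<^sub>v (e \<cdot>\<^sub>v col W 0)"
    unfolding G_def using col_mult2[OF WA mult_carrier_mat[OF H(1) WC(1)], of 0] by simp
  also have "\<dots> = e \<cdot>\<^sub>v col (W\<^sup>H * W) 0"
    using mult_mat_vec[OF WA c0] col_mult2[OF WA WC(1), of 0] by simp
  finally have col0: "col G 0 = e \<cdot>\<^sub>v unit_vec (Suc n) 0"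
    unfolding WC(2) by simp
  have G0: "G $$ (i,0) = (if i = 0 then e else 0)" if "i < Suc n" for i
    using arg_cong[OF col0, of "\<lambda>v. v $ i"] that G by (simp add: unit_vec_def split: if_splits)
  have G0': "G $$ (0,i) = (if i = 0 then e else 0)" if "i < Suc n" for i
    using G0[OF that] arg_cong[OF GH, of "\<lambda>M. M $$ (0,i)"] G that by (cases "i = 0") auto
  have e_real: "e = of_real (Re e)"
    using arg_cong[OF GH, of "\<lambda>M. M $$ (0,0)"] G G0[of 0] by (auto simp: complex_eq_iff)
  define K where "K = mat n n (\<lambda>(i,j). G $$ (Suc i, Suc j))"
  have K: "K \<in> carrier_mat n n" by (simp add: K_def)
  have "K\<^sup>H = K"
  proof (rule eq_matI)
    fix i j assume "i < dim_row K" "j < dim_col K"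
    then show "K\<^sup>H $$ (i,j) = K $$ (i,j)"
      using arg_cong[OF GH, of "\<lambda>M. M $$ (Suc i,Suc j)"] G K by (auto simp: K_def)
  qed (use K in auto)
  then obtain V d where V: "unitary_mat n V" and Kd: "K = V * real_diag n d * V\<^sup>H"
    using Suc.IH[of K] K by (auto simp: hermitian_mats_def)
  have VC: "V \<in> carrier_mat n n" "V\<^sup>H * V = 1\<^sub>m n" "V * V\<^sup>H = 1\<^sub>m n"
    using V by (auto simp: unitary_mat_def)
  note dims = carrier_matD[OF VC(1)] carrier_matD[OF WC(1)] carrier_matD[OF K]
  define V' where "V' = four_block_mat (1\<^sub>m 1) (0\<^sub>m 1 n) (0\<^sub>m n 1) V"
  define d' where "d' i = (case i of 0 \<Rightarrow> Re e | Suc i \<Rightarrow> d i)" for i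
  have D': "real_diag (Suc n) d'
      = four_block_mat (e \<cdot>\<^sub>m 1\<^sub>m 1) (0\<^sub>m 1 n) (0\<^sub>m n 1) (real_diag n d)"
    by (rule eq_matI) (use e_real in \<open>auto simp: d'_def split: nat.splits\<close>)

  have V': "unitary_mat (Suc n) V'"
    unfolding unitary_mat_def
  proof (intro conjI)
    show "V' \<in> carrier_mat (Suc n) (Suc n)"
      by (rule carrier_matI) (simp_all add: V'_def carrier_matD[OF VC(1)])
  qed (simp_all add: V'_def mat_simps carrier_matD[OF VC(1)] VC(2,3) plus_1_eq_Suc del: One_nat_def)
  have "G = four_block_mat (e \<cdot>\<^sub>m 1\<^sub>m 1) (0\<^sub>m 1 n) (0\<^sub>m n 1) K"
  proof (rule eq_matI, goal_cases)
    case (1 i j)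
    then show ?case using G0[of i] G0'[of j] K
      by (cases i; cases j) (auto simp: K_def)
  qed (use G K in auto)
  also have "\<dots> = V' * real_diag (Suc n) d' * V'\<^sup>H"
    unfolding D' Kd V'_def by (simp add: mat_simps dims)
  finally have "H = (W * V') * real_diag (Suc n) d' * (W * V')\<^sup>H"
    using WC(1) V' unfolding HW by (auto simp: mat_simps unitary_mat_def)
  then show ?case using unitary_mult[OF W V'] by blast
qed

section \<open>The Moore--Penrose inverse\<close>

text \<open>\<open>A X\<close> and \<open>A Y\<close> are orthogonal projections onto the same space, namely the column space of
  \<open>A\<close>, and likewise \<open>X A\<close> and \<open>Y A\<close>; hence \<open>X = X A X = X A Y = Y A Y = Y\<close>.\<close>

lemma mp_inverse_unique:
  assumes "is_mp_inverse A X" "is_mp_inverse A Y"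
  shows "X = Y"
proof -
  have d: "dim_row X = dim_col A" "dim_col X = dim_row A" "dim_row Y = dim_col A" "dim_col Y = dim_row A"
    using assms by (auto simp: is_mp_inverse_def)
  have X: "A * X * A = A" "X * A * X = X" "(A * X)\<^sup>H = A * X" "(X * A)\<^sup>H = X * A"
    and Y: "A * Y * A = A" "Y * A * Y = Y" "(A * Y)\<^sup>H = A * Y" "(Y * A)\<^sup>H = Y * A"
    using assms by (auto simp: is_mp_inverse_def)
  have "A * X = (A * Y) * (A * X)"
    using Y(1) d by (metis mult_assoc_dim index_mult_mat(2,3))
  then have "A * X = (A * X) * (A * Y)"
    using X(3) Y(3) d adjoint_mult[of "A * Y" "A * X"] by simp
  also have "\<dots> = A * Y"
    using X(1) d by (metis mult_assoc_dim index_mult_mat(2,3))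
  finally have AX: "A * X = A * Y" .
  have "X * A = (X * A) * (Y * A)"
    using Y(1) d by (metis mult_assoc_dim index_mult_mat(2,3))
  then have "X * A = (Y * A) * (X * A)"
    using X(4) Y(4) d adjoint_mult[of "X * A" "Y * A"] by simp
  also have "\<dots> = Y * A"
    using X(1) d by (metis mult_assoc_dim index_mult_mat(2,3))
  finally have XA: "X * A = Y * A" .
  have "X = X * (A * X)" using X(2) d by (simp add: mult_assoc_dim)
  also have "\<dots> = (X * A) * Y" unfolding AX using d by (simp add: mult_assoc_dim)
  also have "\<dots> = Y" unfolding XA by (rule Y(2))
  finally show ?thesis .
qed

text \<open>For a hermitian matrix one inverts the nonzero eigenvalues; in general
  \<open>(A\<^sup>H A)\<^sup>\<dagger> A\<^sup>H\<close> works, where \<open>A (A\<^sup>H A)\<^sup>\<dagger> A\<^sup>H A = A\<close> holds because \<open>A\<^sup>H\<close> can be cancelled from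
  the corresponding identity for \<open>A\<^sup>H A\<close>.\<close>

lemma mp_inverse_exists: "\<exists>X. is_mp_inverse A X"
proof -
  define m n where "m = dim_row A" and "n = dim_col A"
  have A: "A \<in> carrier_mat m n" by (auto simp: m_def n_def)
  define C where "C = A\<^sup>H * A"
  have C: "C \<in> hermitian_mats n"
    using A by (auto simp: C_def hermitian_mats_def mat_simps)
  obtain U d where U: "unitary_mat n U" and CU: "C = U * real_diag n d * U\<^sup>H"
    using spectral_decomposition[OF C] by blast
  have UC: "U \<in> carrier_mat n n" "U\<^sup>H * U = 1\<^sub>m n"
    using U by (auto simp: unitary_mat_def)
  \<comment> \<open>Zero eigenvalues stay zero, because \<open>inverse 0 = 0\<close>.\<close>
  define G where "G = U * real_diag n (\<lambda>i. inverse (d i)) * U\<^sup>H"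
  note dm = carrier_matD[OF UC(1)] carrier_matD[OF A]
  have G: "G \<in> carrier_mat n n" using UC by (auto simp: G_def)
  note dm = dm carrier_matD[OF G]
  have dd: "(\<lambda>i. inverse (d i) * (d i * inverse (d i))) = (\<lambda>i. inverse (d i))"
    "(\<lambda>i. d i * (inverse (d i) * d i)) = d"
    by (rule ext; case_tac "d i = 0"; simp)+
  have GH: "G\<^sup>H = G" by (simp add: G_def mat_simps dm)
  have GC: "G * C = U * (real_diag n (\<lambda>i. inverse (d i) * d i) * U\<^sup>H)"
    by (simp add: G_def CU mat_simps dm mult_chain[OF UC(2)] mult_chain[OF real_diag_mult])
  have GCG: "G * C * G = G"
    unfolding GC by (simp add: G_def mat_simps dm mult_chain[OF UC(2)] mult_chain[OF real_diag_mult] dd mult.assoc)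
  have CGC: "C * (G * C) = C"
    unfolding GC by (simp add: CU mat_simps dm mult_chain[OF UC(2)] mult_chain[OF real_diag_mult] dd)
  have GCH: "(G * C)\<^sup>H = G * C"
    unfolding GC by (simp add: mat_simps dm)
  have Cd: "C \<in> carrier_mat n n" using C by (auto simp: hermitian_mats_def)
  have "A\<^sup>H * (A * (G * C - 1\<^sub>m n)) = C * (G * C - 1\<^sub>m n)"
    using Cd by (simp add: C_def mat_simps dm)
  also have "\<dots> = 0\<^sub>m n n"
    using Cd CGC G by (simp add: mat_simps)
  finally have "A * (G * C - 1\<^sub>m n) = 0\<^sub>m m n"
    by (intro gram_cancel[OF A]) (use G Cd in auto)
  then have "A * (G * C) - A = 0\<^sub>m m n"
    using Cd by (simp add: mat_simps dm)
  then have AGC: "A * (G * C) = A"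
    by (subst (asm) minus_eq_zero_mat_iff) (use A G Cd in auto)
  have "is_mp_inverse A (G * A\<^sup>H)"
    unfolding is_mp_inverse_def
  proof (intro conjI)
    show "G * A\<^sup>H \<in> carrier_mat (dim_col A) (dim_row A)" using G A by auto
    show "A * (G * A\<^sup>H) * A = A" using AGC by (simp add: mat_simps dm C_def)
    show "G * A\<^sup>H * A * (G * A\<^sup>H) = G * A\<^sup>H"
      using arg_cong[OF GCG, of "\<lambda>M. M * A\<^sup>H"] by (simp add: mat_simps dm C_def)
    show "(A * (G * A\<^sup>H))\<^sup>H = A * (G * A\<^sup>H)" using GH by (simp add: mat_simps dm)
    show "(G * A\<^sup>H * A)\<^sup>H = G * A\<^sup>H * A" using GCH by (simp add: mat_simps dm C_def)
  qed
  then show ?thesis ..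
qed

lemma is_mp_inverse_mp: "is_mp_inverse A A\<^sup>\<dagger>"
  unfolding mp_inverse_def
  using theI'[of "is_mp_inverse A"] mp_inverse_exists mp_inverse_unique by blast

lemma mp_inverse_eqI: "is_mp_inverse A X \<Longrightarrow> A\<^sup>\<dagger> = X"
  using mp_inverse_unique is_mp_inverse_mp by blast

lemma mp_dim [simp]: "dim_row A\<^sup>\<dagger> = dim_col A" "dim_col A\<^sup>\<dagger> = dim_row A"
  using is_mp_inverse_mp[of A] by (auto simp: is_mp_inverse_def)

lemma mp_carrier [simp]: "A \<in> carrier_mat n k \<Longrightarrow> A\<^sup>\<dagger> \<in> carrier_mat k n"
  by (auto intro: carrier_matI)

lemma mp_mult [mat_simps]:
  "A * (A\<^sup>\<dagger> * A) = A" "A\<^sup>\<dagger> * (A * A\<^sup>\<dagger>) = A\<^sup>\<dagger>"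
  "(A\<^sup>\<dagger>)\<^sup>H * A\<^sup>H = A * A\<^sup>\<dagger>" "A\<^sup>H * (A\<^sup>\<dagger>)\<^sup>H = A\<^sup>\<dagger> * A"
  using is_mp_inverse_mp[of A] by (auto simp: is_mp_inverse_def mat_simps)

lemma mp_mult_chain [mat_simps]:
  "dim_row X = dim_col A \<Longrightarrow> A * (A\<^sup>\<dagger> * (A * X)) = A * X"
  "dim_row X = dim_row A \<Longrightarrow> A\<^sup>\<dagger> * (A * (A\<^sup>\<dagger> * X)) = A\<^sup>\<dagger> * X"
  "dim_row X = dim_row A \<Longrightarrow> (A\<^sup>\<dagger>)\<^sup>H * (A\<^sup>H * X) = A * (A\<^sup>\<dagger> * X)"
  "dim_row X = dim_col A \<Longrightarrow> A\<^sup>H * ((A\<^sup>\<dagger>)\<^sup>H * X) = A\<^sup>\<dagger> * (A * X)"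
  using mult_chain[OF mp_mult(1)[of A], of X] mult_chain[OF mp_mult(2)[of A], of X]
    mult_chain[OF mp_mult(3)[of A], of X] mult_chain[OF mp_mult(4)[of A], of X]
  by (simp_all add: mult_assoc_dim)

lemma mp_mult_adjoint [mat_simps]:
  "A\<^sup>H * (A * A\<^sup>\<dagger>) = A\<^sup>H" "A\<^sup>\<dagger> * (A * A\<^sup>H) = A\<^sup>H"
  "(A\<^sup>\<dagger>)\<^sup>H * (A\<^sup>\<dagger> * A) = (A\<^sup>\<dagger>)\<^sup>H" "A * (A\<^sup>\<dagger> * (A\<^sup>\<dagger>)\<^sup>H) = (A\<^sup>\<dagger>)\<^sup>H"
proof -
  have AX: "(A * A\<^sup>\<dagger>)\<^sup>H = A * A\<^sup>\<dagger>" and XA: "(A\<^sup>\<dagger> * A)\<^sup>H = A\<^sup>\<dagger> * A"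
    using is_mp_inverse_mp[of A] by (auto simp: is_mp_inverse_def)
  show "A\<^sup>H * (A * A\<^sup>\<dagger>) = A\<^sup>H"
    using adjoint_mult[of "A * A\<^sup>\<dagger>" A] unfolding AX by (simp add: mult_assoc_dim mp_mult(1))
  show "A\<^sup>\<dagger> * (A * A\<^sup>H) = A\<^sup>H"
    using adjoint_mult[of A "A\<^sup>\<dagger> * A"] unfolding XA by (simp add: mult_assoc_dim mp_mult(1))
  show "(A\<^sup>\<dagger>)\<^sup>H * (A\<^sup>\<dagger> * A) = (A\<^sup>\<dagger>)\<^sup>H"
    using adjoint_mult[of "A\<^sup>\<dagger> * A" "A\<^sup>\<dagger>"] unfolding XA by (simp add: mult_assoc_dim mp_mult(2))
  show "A * (A\<^sup>\<dagger> * (A\<^sup>\<dagger>)\<^sup>H) = (A\<^sup>\<dagger>)\<^sup>H"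
    using adjoint_mult[of "A\<^sup>\<dagger>" "A * A\<^sup>\<dagger>"] unfolding AX by (simp add: mult_assoc_dim mp_mult(2))
qed

lemma mp_adjoint: "(A\<^sup>H)\<^sup>\<dagger> = (A\<^sup>\<dagger>)\<^sup>H"
  by (rule mp_inverse_eqI) (auto simp: is_mp_inverse_def mat_simps intro!: carrier_matI)

lemma mp_hermitian:
  assumes "A\<^sup>H = A"
  shows "(A\<^sup>\<dagger>)\<^sup>H = A\<^sup>\<dagger>" "A\<^sup>\<dagger> * A = A * A\<^sup>\<dagger>"
proof -
  show *: "(A\<^sup>\<dagger>)\<^sup>H = A\<^sup>\<dagger>" using mp_adjoint[of A] assms by simp
  show "A\<^sup>\<dagger> * A = A * A\<^sup>\<dagger>" using mp_mult(3)[of A] assms * by simp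
qed

lemma mp_zero: "(0\<^sub>m n k)\<^sup>\<dagger> = 0\<^sub>m k n"
  by (rule mp_inverse_eqI) (auto simp: is_mp_inverse_def mat_simps)

lemma E_proj_dim [simp]: "dim_row (E_proj B) = dim_row B" "dim_col (E_proj B) = dim_row B"
  by (auto simp: E_proj_def)

lemma F_proj_dim [simp]: "dim_row (F_proj B) = dim_col B" "dim_col (F_proj B) = dim_col B"
  by (auto simp: F_proj_def)

lemma E_proj_facts [mat_simps]:
  "(E_proj B)\<^sup>H = E_proj B" "E_proj B * E_proj B = E_proj B"
  "E_proj B * B = 0\<^sub>m (dim_row B) (dim_col B)" "B\<^sup>\<dagger> * E_proj B = 0\<^sub>m (dim_col B) (dim_row B)"
  by (auto simp: E_proj_def mat_simps)

lemma F_proj_facts [mat_simps]: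
  "(F_proj B)\<^sup>H = F_proj B" "F_proj B * F_proj B = F_proj B"
  "B * F_proj B = 0\<^sub>m (dim_row B) (dim_col B)" "F_proj B * B\<^sup>\<dagger> = 0\<^sub>m (dim_col B) (dim_row B)"
  by (auto simp: F_proj_def mat_simps)

lemma E_proj_chain [mat_simps]:
  "dim_row X = dim_row B \<Longrightarrow> E_proj B * (E_proj B * X) = E_proj B * X"
  "dim_row X = dim_col B \<Longrightarrow> E_proj B * (B * X) = 0\<^sub>m (dim_row B) (dim_col X)"
  "dim_row X = dim_row B \<Longrightarrow> B\<^sup>\<dagger> * (E_proj B * X) = 0\<^sub>m (dim_col B) (dim_col X)"
  by (simp_all add: mult_chain[OF E_proj_facts(2)] mult_chain[OF E_proj_facts(3)]
    mult_chain[OF E_proj_facts(4)] mat_simps)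

lemma F_proj_chain [mat_simps]:
  "dim_row X = dim_col B \<Longrightarrow> B * (F_proj B * X) = 0\<^sub>m (dim_row B) (dim_col X)"
  by (simp add: mult_chain[OF F_proj_facts(3)] mat_simps)

lemma E_proj_adjoint [mat_simps]:
  "B\<^sup>H * E_proj B = 0\<^sub>m (dim_col B) (dim_row B)"
  "dim_row X = dim_row B \<Longrightarrow> B\<^sup>H * (E_proj B * X) = 0\<^sub>m (dim_col B) (dim_col X)"
proof -
  show *: "B\<^sup>H * E_proj B = 0\<^sub>m (dim_col B) (dim_row B)"
    using arg_cong[OF E_proj_facts(3)[of B], of mat_adjoint]
    by (simp add: adjoint_mult adjoint_zero E_proj_facts(1))
  show "dim_row X = dim_row B \<Longrightarrow> B\<^sup>H * (E_proj B * X) = 0\<^sub>m (dim_col B) (dim_col X)"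
    by (simp add: mult_chain[OF *] mat_simps)
qed

lemma F_proj_adjoint [mat_simps]:
  "F_proj B * B\<^sup>H = 0\<^sub>m (dim_col B) (dim_row B)"
  "dim_row X = dim_row B \<Longrightarrow> F_proj B * (B\<^sup>H * X) = 0\<^sub>m (dim_col B) (dim_col X)"
proof -
  show *: "F_proj B * B\<^sup>H = 0\<^sub>m (dim_col B) (dim_row B)"
    using arg_cong[OF F_proj_facts(3)[of B], of mat_adjoint]
    by (simp add: adjoint_mult adjoint_zero F_proj_facts(1))
  show "dim_row X = dim_row B \<Longrightarrow> F_proj B * (B\<^sup>H * X) = 0\<^sub>m (dim_col B) (dim_col X)"
    by (simp add: mult_chain[OF *] mat_simps)
qed

section \<open>Positive semidefinite matrices as Gram matrices\<close>

lemma scalar_prod_gram: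
  fixes X :: "complex mat"
  assumes "X \<in> carrier_mat n k" "v \<in> carrier_vec n"
  shows "(X * X\<^sup>H *\<^sub>v v) \<bullet>c v = (X\<^sup>H *\<^sub>v v) \<bullet>c (X\<^sup>H *\<^sub>v v)"
proof -
  have "(X * X\<^sup>H *\<^sub>v v) \<bullet>c v = (X *\<^sub>v (X\<^sup>H *\<^sub>v v)) \<bullet>c v"
    using assms by (subst assoc_mult_mat_vec[of X n k]) auto
  then show ?thesis
    using assms scalar_prod_adjoint[of X n k "X\<^sup>H *\<^sub>v v" v]
    by (simp add: mult_mat_vec_carrier[of _ k n])
qed

lemma pos_semidef_gram:
  fixes X :: "complex mat"
  assumes "X \<in> carrier_mat n k"
  shows "pos_semidef (X * X\<^sup>H)"
proof -
  have "X * X\<^sup>H \<in> hermitian_mats n"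
    using assms by (auto simp: hermitian_mats_def mat_simps)
  moreover have "0 \<le> (X * X\<^sup>H *\<^sub>v v) \<bullet>c v" if "v \<in> carrier_vec n" for v
    unfolding scalar_prod_gram[OF assms that] by (rule conjugate_square_ge_0_vec)
  ultimately show ?thesis
    using assms by (auto simp: pos_semidef_def)
qed

lemma pos_semidef_factor:
  assumes P: "pos_semidef P" and d: "dim_row P = n"
  shows "\<exists>W \<in> carrier_mat n n. P = W * W\<^sup>H"
proof -
  have H: "P \<in> hermitian_mats n" and pos: "\<And>v. v \<in> carrier_vec n \<Longrightarrow> 0 \<le> (P *\<^sub>v v) \<bullet>c v"
    using P d by (auto simp: pos_semidef_def)
  obtain U e where U: "unitary_mat n U" and PU: "P = U * real_diag n e * U\<^sup>H"
    using spectral_decomposition[OF H] by blast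
  have UC: "U \<in> carrier_mat n n" "U\<^sup>H * U = 1\<^sub>m n"
    using U by (auto simp: unitary_mat_def)
  note dm = carrier_matD[OF UC(1)]
  have PC: "P \<in> carrier_mat n n" using H by (auto simp: hermitian_mats_def)
  \<comment> \<open>An eigenvalue is the value of the quadratic form at its unit eigenvector.\<close>
  have e: "0 \<le> e i" if i: "i < n" for i
  proof -
    have "complex_of_real (e i) = (U\<^sup>H * (P * U)) $$ (i,i)"
      unfolding PU using i UC(2) by (simp add: mat_simps dm mult_chain[OF UC(2)] del: index_mult_mat(1))
    also have "\<dots> = (P *\<^sub>v col U i) \<bullet>c col U i"
      using i UC PC by (subst index_mult_mat)
        (auto simp: scalar_prod_def mult.commute intro!: sum.cong)
    finally have "complex_of_real (e i) = (P *\<^sub>v col U i) \<bullet>c col U i" .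
    moreover have "0 \<le> (P *\<^sub>v col U i) \<bullet>c col U i"
      using pos[of "col U i"] dm by (simp add: carrier_vecI)
    ultimately have "0 \<le> complex_of_real (e i)" by simp
    then show ?thesis by (simp add: less_eq_complex_def)
  qed
  define W where "W = U * real_diag n (\<lambda>i. sqrt (e i))"
  have "W * W\<^sup>H = U * (real_diag n (\<lambda>i. sqrt (e i) * sqrt (e i)) * U\<^sup>H)"
    by (simp add: W_def mat_simps dm mult_chain[OF real_diag_mult])
  also have "real_diag n (\<lambda>i. sqrt (e i) * sqrt (e i)) = real_diag n e"
    using e by (intro eq_matI) auto
  finally have "P = W * W\<^sup>H" unfolding PU by (simp add: mat_simps dm)
  moreover have "W \<in> carrier_mat n n" using UC by (auto simp: W_def)
  ultimately show ?thesis by blast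
qed

lemma pos_semidef_congruence:
  assumes "pos_semidef P" "dim_row P = n" "C \<in> carrier_mat k n"
  shows "pos_semidef (C * P * C\<^sup>H)"
proof -
  obtain W where W: "W \<in> carrier_mat n n" "P = W * W\<^sup>H"
    using pos_semidef_factor[OF assms(1,2)] by blast
  have "C * P * C\<^sup>H = (C * W) * (C * W)\<^sup>H"
    using W assms(3) by (simp add: mat_simps)
  then show ?thesis using pos_semidef_gram[of "C * W" k n] W assms(3) by auto
qed

lemma pos_semidef_carrier: "pos_semidef P \<Longrightarrow> dim_row P = n \<Longrightarrow> P \<in> carrier_mat n n \<and> P\<^sup>H = P"
  by (auto simp: pos_semidef_def hermitian_mats_def)

lemma pos_semidef_add:
  assumes P: "pos_semidef P" "dim_row P = n" and Q: "pos_semidef Q" "dim_row Q = n"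
  shows "pos_semidef (P + Q)"
proof -
  have c: "P \<in> carrier_mat n n" "P\<^sup>H = P" "Q \<in> carrier_mat n n" "Q\<^sup>H = Q"
    using pos_semidef_carrier P Q by auto
  have "0 \<le> ((P + Q) *\<^sub>v v) \<bullet>c v" if v: "v \<in> carrier_vec n" for v
  proof -
    have "((P + Q) *\<^sub>v v) \<bullet>c v = (P *\<^sub>v v) \<bullet>c v + (Q *\<^sub>v v) \<bullet>c v"
      using c v by (simp add: add_mult_distrib_mat_vec[of _ n n] add_scalar_prod_distrib[of _ n])
    then show ?thesis using P Q v by (auto simp: pos_semidef_def)
  qed
  then show ?thesis
    using c by (auto simp: pos_semidef_def hermitian_mats_def mat_simps)
qed

section \<open>Rank as the trace of a projection\<close>

text \<open>The columns of \<open>I - K\<^sup>\<dagger> K\<close> lie in the kernel of \<open>K\<close>.\<close>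

lemma injective_left_inverse:
  fixes K :: "complex mat"
  assumes K: "K \<in> carrier_mat m k"
    and inj: "\<And>v. v \<in> carrier_vec k \<Longrightarrow> K *\<^sub>v v = 0\<^sub>v m \<Longrightarrow> v = 0\<^sub>v k"
  shows "K\<^sup>\<dagger> * K = 1\<^sub>m k"
proof -
  define Z where "Z = 1\<^sub>m k - K\<^sup>\<dagger> * K"
  have Z: "Z \<in> carrier_mat k k" using K by (auto simp: Z_def intro!: carrier_matI)
  have KZ: "K * Z = 0\<^sub>m m k"
    using K by (auto simp: Z_def mat_simps)
  have "Z = 0\<^sub>m k k"
  proof (rule eq_matI)
    fix i j assume ij: "i < dim_row (0\<^sub>m k k)" "j < dim_col (0\<^sub>m k k)"
    have "K *\<^sub>v col Z j = 0\<^sub>v m"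
      using col_mult2[OF K Z, of j] ij KZ by simp
    then have "col Z j = 0\<^sub>v k"
      using inj[of "col Z j"] carrier_matD[OF Z] by (simp add: carrier_vecI)
    then have "col Z j $ i = 0" using ij by simp
    then show "Z $$ (i,j) = 0\<^sub>m k k $$ (i,j)" using Z ij by simp
  qed (use Z in auto)
  then have "1\<^sub>m k = K\<^sup>\<dagger> * K"
    unfolding Z_def using K by (subst (asm) minus_eq_zero_mat_iff) (auto intro!: carrier_matI)
  then show ?thesis ..
qed

text \<open>The columns of \<open>K\<close> are a maximal independent set of columns of \<open>A\<close>. This is the only place
  where the rank is handled through spans and bases.\<close>

lemma rank_factorization:
  assumes A: "A \<in> carrier_mat m n"
  shows "\<exists>K X Y. K \<in> carrier_mat m (mrank A) \<and> X \<in> carrier_mat (mrank A) n \<and>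
    Y \<in> carrier_mat n (mrank A) \<and> A = K * X \<and> K = A * Y \<and> K\<^sup>\<dagger> * K = 1\<^sub>m (mrank A)"
proof -
  interpret vec_space "TYPE(complex)" m .
  have rk: "mrank A = rank A" using A by simp
  define C where "C = set (cols A)"
  have C: "finite C" "C \<subseteq> carrier_vec m"
    using A cols_dim[of A] by (auto simp: C_def)
  obtain S where S: "maximal S (\<lambda>T. T \<subseteq> C \<and> lin_indpt T)"
  proof -
    have "lin_indpt {}"
      by (metis empty_subsetI fin_dim finite_basis_exists subset_li_is_li vec_vs vectorspace.basis_def)
    then show ?thesis
      using maximal_exists_superset[of C "\<lambda>T. T \<subseteq> C \<and> lin_indpt T" "{}"] C(1) that by auto
  qed
  have SC: "S \<subseteq> C" "lin_indpt S" "S \<subseteq> carrier_vec m" "finite S"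
    using S C by (auto simp: maximal_def intro: finite_subset)
  have card: "rank A = card S"
    using rank_card_indpt[OF A] S by (simp add: C_def)
  obtain ks where ks: "set ks = S" "distinct ks"
    using finite_distinct_list[OF SC(4)] by blast
  define r where "r = rank A"
  have len: "length ks = r" using ks card distinct_card by (fastforce simp: r_def)
  define K where "K = mat_of_cols m ks"
  have K: "K \<in> carrier_mat m r" by (rule carrier_matI) (simp_all add: K_def len)
  have colsK: "cols K = ks" using ks SC by (auto simp: K_def)
  have span: "c \<in> span S" if c: "c \<in> C" for c
  proof (rule ccontr)
    assume c': "c \<notin> span S"
    then have "c \<notin> S" using SC(3) span_mem by blast
    moreover have "lin_indpt (S \<union> {c})"
      using lin_dep_iff_in_span[OF SC(3,2) _ \<open>c \<notin> S\<close>] c c' C by auto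
    ultimately show False
      using S c SC(1) unfolding maximal_def by blast
  qed
  have "\<exists>x \<in> carrier_vec r. K *\<^sub>v x = c" if c: "c \<in> C" for c
  proof -
    obtain a where "lincomb a S = c"
      using finite_in_span[OF SC(4) _ span[OF c]] SC(3) by auto
    then show ?thesis
      using mat_mult_eq_lincomb[OF K, of a] ks by (auto simp: colsK)
  qed
  then obtain f where f: "\<And>c. c \<in> C \<Longrightarrow> f c \<in> carrier_vec r \<and> K *\<^sub>v f c = c" by metis
  define X where "X = mat_of_cols r (map f (cols A))"
  have X: "X \<in> carrier_mat r n" using A by (intro carrier_matI) (simp_all add: X_def)
  have colA: "col A j \<in> C" if "j < n" for j
    using that A by (auto simp: C_def cols_def)
  have "col (K * X) j = col A j" if j: "j < n" for j
  proof -
    have "col X j = f (col A j)"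
      using j A f[OF colA[OF j]] unfolding X_def by (subst col_mat_of_cols) auto
    then show ?thesis
      using col_mult2[OF K X j] f[OF colA[OF j]] by simp
  qed
  then have AKX: "A = K * X"
    using A K X by (intro mat_col_eqI) auto
  have "\<exists>i<n. ks ! j = col A i" if "j < r" for j
  proof -
    have "ks ! j \<in> C" using that len ks SC(1) by auto
    then show ?thesis using A by (auto simp: C_def in_set_conv_nth)
  qed
  then obtain g where g: "\<And>j. j < r \<Longrightarrow> g j < n \<and> ks ! j = col A (g j)" by metis
  define Y :: "complex mat" where "Y = mat_of_cols n (map (\<lambda>j. unit_vec n (g j)) [0..<r])"
  have Y: "Y \<in> carrier_mat n r" by (intro carrier_matI) (simp_all add: Y_def)
  have "col (A * Y) j = col K j" if j: "j < r" for j
  proof -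
    have "col Y j = unit_vec n (g j)"
      using j unfolding Y_def by (subst col_mat_of_cols) auto
    moreover have "A *\<^sub>v unit_vec n (g j) = col A (g j)"
      using A g[OF j] by (intro eq_vecI) auto
    moreover have "col K j = ks ! j"
      using j len ks SC unfolding K_def by (subst col_mat_of_cols) auto
    ultimately show ?thesis
      using col_mult2[OF A Y j] g[OF j] by simp
  qed
  then have KAY: "K = A * Y"
    using A K Y by (intro mat_col_eqI) auto
  have "K\<^sup>\<dagger> * K = 1\<^sub>m r"
  proof (rule injective_left_inverse[OF K])
    fix v assume "v \<in> carrier_vec r" "K *\<^sub>v v = 0\<^sub>v m"
    then show "v = 0\<^sub>v r"
      using lin_depI[OF K, of v] SC(2) ks colsK by auto
  qed
  then show ?thesis
    using K X Y AKX KAY unfolding rk r_def by blast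
qed

text \<open>\<open>A Y\<close> is a projection onto the column space of \<open>A\<close>. With the factorisation \<open>A = K X\<close>
  through dimension \<open>r(A)\<close>, cyclicity moves the trace of \<open>A Y = K X Y\<close> to that of \<open>X Y K\<close>, which
  is the identity of size \<open>r(A)\<close>.\<close>

lemma mrank_eq_trace:
  assumes A: "A \<in> carrier_mat m n" and Y: "Y \<in> carrier_mat n m"
    and T: "A * Y * A = A"
  shows "of_nat (mrank A) = mat_trace (A * Y)"
proof -
  define r where "r = mrank A"
  obtain K X Z where K: "K \<in> carrier_mat m r" and X: "X \<in> carrier_mat r n"
    and Z: "Z \<in> carrier_mat n r" and A1: "A = K * X" and K1: "K = A * Z" and K2: "K\<^sup>\<dagger> * K = 1\<^sub>m r"
    using rank_factorization[OF A] unfolding r_def by blast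
  note d = carrier_matD[OF K] carrier_matD[OF X] carrier_matD[OF Y] carrier_matD[OF A] carrier_matD[OF Z]
  have TK: "A * (Y * K) = K"
    using arg_cong[OF T, of "\<lambda>M. M * Z"] unfolding K1 by (simp add: mult_assoc_dim d)
  have "K\<^sup>\<dagger> * (K * (X * (Y * K))) = K\<^sup>\<dagger> * K"
    using TK by (simp add: A1 mat_simps d)
  then have XYK: "X * (Y * K) = 1\<^sub>m r"
    using K2 by (simp add: mult_chain[OF K2] mat_simps d)
  have "mat_trace (A * Y) = mat_trace (K * (X * Y))"
    by (simp add: A1 mat_simps d)
  also have "\<dots> = mat_trace ((X * Y) * K)"
    by (rule mat_trace_comm) (use K X Y in auto)
  also have "\<dots> = of_nat r"
    using XYK by (simp add: mat_simps d)
  finally show ?thesis by (simp add: r_def)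
qed

lemma mrank_mp: "of_nat (mrank A) = mat_trace (A * A\<^sup>\<dagger>)"
  by (rule mrank_eq_trace[of _ "dim_row A" "dim_col A"]) (auto simp: mat_simps)

lemma projection_trace:
  assumes P: "P \<in> carrier_mat n n" "P\<^sup>H = P" "P * P = P"
    and Q: "Q \<in> carrier_mat n n" "Q\<^sup>H = Q" "Q * Q = Q"
    and QP: "Q * P = P"
  shows "mat_trace Q - mat_trace P = mat_trace ((Q - P)\<^sup>H * (Q - P))"
proof -
  have PQ: "P * Q = P"
    using arg_cong[OF QP, of mat_adjoint] P Q by (simp add: mat_simps)
  have "(Q - P)\<^sup>H * (Q - P) = Q - P"
    using P Q QP PQ by (auto simp: mat_simps intro!: eq_matI)
  then show ?thesis using mat_trace_minus P Q by simp
qed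

lemma mat_trace_gram_nonneg:
  "X \<in> carrier_mat n k \<Longrightarrow> 0 \<le> mat_trace (X\<^sup>H * X)"
  by (auto simp: mat_trace_def scalar_prod_def less_eq_complex_def sum.distrib
    intro!: sum_nonneg add_nonneg_nonneg)

text \<open>The hypothesis says that the column space of \<open>A\<close> lies in that of \<open>C\<close>. Then the difference of
  the two orthogonal projections is again an orthogonal projection; its trace is the difference of
  the ranks, and it vanishes only if the two projections coincide.\<close>

lemma column_space_rank:
  assumes A: "A \<in> carrier_mat m n" and C: "C \<in> carrier_mat m k" and CA: "C * C\<^sup>\<dagger> * A = A"
  shows "mrank A \<le> mrank C" "mrank A = mrank C \<Longrightarrow> A * A\<^sup>\<dagger> * C = C"
proof -
  note d = carrier_matD[OF A] carrier_matD[OF C]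
  let ?P = "A * A\<^sup>\<dagger>" and ?Q = "C * C\<^sup>\<dagger>"
  have PQ: "?P \<in> carrier_mat m m" "?Q \<in> carrier_mat m m" using A C by (auto intro!: carrier_matI)
  have "?Q * ?P = ?P"
    using arg_cong[OF CA, of "\<lambda>M. M * A\<^sup>\<dagger>"] by (simp add: mat_simps d)
  then have tr: "mat_trace ?Q - mat_trace ?P = mat_trace ((?Q - ?P)\<^sup>H * (?Q - ?P))"
    by (intro projection_trace[OF PQ(1) _ _ PQ(2)]) (simp_all add: mat_simps d)
  have D: "?Q - ?P \<in> carrier_mat m m" by (intro carrier_matI) (simp_all add: d)
  have "0 \<le> complex_of_nat (mrank C) - of_nat (mrank A)"
    unfolding mrank_mp tr by (rule mat_trace_gram_nonneg[OF D])
  then show "mrank A \<le> mrank C" by (simp add: less_eq_complex_def)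
  assume "mrank A = mrank C"
  then have "?Q - ?P = 0\<^sub>m m m"
    using mrank_mp[of A] mrank_mp[of C] tr mat_trace_gram_eq_zero[OF D] by simp
  then have "?Q = ?P" using minus_eq_zero_mat_iff[OF PQ(2,1)] by simp
  then show "A * A\<^sup>\<dagger> * C = C" by (metis mp_mult(1) mult_assoc_dim mp_dim)
qed

lemma mrank_mult_left:
  assumes "A \<in> carrier_mat m n" "B \<in> carrier_mat n k"
  shows "mrank (A * B) \<le> mrank A"
  by (rule column_space_rank(1)[of _ m k _ n]) (use assms in \<open>auto simp: mat_simps\<close>)

lemma mrank_adjoint: "mrank A\<^sup>H = mrank A"
proof -
  have "of_nat (mrank A\<^sup>H) = mat_trace (A\<^sup>H * (A\<^sup>\<dagger>)\<^sup>H)"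
    using mrank_mp[of "A\<^sup>H"] by (simp add: mp_adjoint)
  also have "\<dots> = mat_trace (A\<^sup>\<dagger> * A)" by (simp add: mat_simps)
  also have "\<dots> = mat_trace (A * A\<^sup>\<dagger>)"
    by (rule mat_trace_comm[of _ "dim_col A" "dim_row A"]) auto
  also have "\<dots> = of_nat (mrank A)" by (simp add: mrank_mp)
  finally show ?thesis by simp
qed

lemma mrank_mult_right:
  assumes "A \<in> carrier_mat m n" "B \<in> carrier_mat n k"
  shows "mrank (A * B) \<le> mrank B"
proof -
  have "mrank (A * B) = mrank (B\<^sup>H * A\<^sup>H)"
    using mrank_adjoint[of "A * B"] assms by (simp add: mat_simps)
  also have "\<dots> \<le> mrank B\<^sup>H" by (rule mrank_mult_left[of _ k n _ m]) (use assms in auto)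
  finally show ?thesis unfolding mrank_adjoint .
qed

lemma mrank_eq_0:
  assumes "A \<in> carrier_mat n k" "mrank A = 0"
  shows "A = 0\<^sub>m n k"
proof -
  have "0\<^sub>m n k * (0\<^sub>m n k)\<^sup>\<dagger> * A = A"
    by (rule column_space_rank(2)[of _ n k]) (use assms in \<open>auto simp: mat_simps vec_space.rank_0I\<close>)
  then show ?thesis using assms by (simp add: mat_simps)
qed

lemma mp_one: "(1\<^sub>m n)\<^sup>\<dagger> = 1\<^sub>m n"
  by (rule mp_inverse_eqI) (auto simp: is_mp_inverse_def mat_simps)

lemma mrank_full_iff:
  assumes A: "A \<in> carrier_mat m n"
  shows "mrank A = m \<longleftrightarrow> A * A\<^sup>\<dagger> = 1\<^sub>m m"
proof
  assume "mrank A = m"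
  moreover have "mrank (1\<^sub>m m) = m"
    using mrank_eq_trace[of "1\<^sub>m m" m m "1\<^sub>m m"] by simp
  ultimately have "A * A\<^sup>\<dagger> * 1\<^sub>m m = 1\<^sub>m m"
    by (intro column_space_rank(2)[OF A, of _ m]) (use A in \<open>auto simp: mat_simps mp_one\<close>)
  then show "A * A\<^sup>\<dagger> = 1\<^sub>m m" using A by (simp add: mat_simps)
next
  assume "A * A\<^sup>\<dagger> = 1\<^sub>m m"
  then show "mrank A = m" using mrank_mp[of A] by simp
qed

lemma mrank_block_diag:
  assumes A: "A \<in> carrier_mat m n" and D: "D \<in> carrier_mat k l"
  shows "mrank (four_block_mat A (0\<^sub>m m l) (0\<^sub>m k n) D) = mrank A + mrank D"
proof -
  note d = carrier_matD[OF A] carrier_matD[OF D]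
  let ?M = "four_block_mat A (0\<^sub>m m l) (0\<^sub>m k n) D"
  let ?Y = "four_block_mat A\<^sup>\<dagger> (0\<^sub>m n k) (0\<^sub>m l m) D\<^sup>\<dagger>"
  have MY: "?M * ?Y = four_block_mat (A * A\<^sup>\<dagger>) (0\<^sub>m m k) (0\<^sub>m k m) (D * D\<^sup>\<dagger>)"
    by (simp add: mat_simps d)
  have "of_nat (mrank ?M) = mat_trace (?M * ?Y)"
    by (rule mrank_eq_trace[of _ "m + k" "n + l"]) (use A D in \<open>auto simp: mat_simps intro!: carrier_matI\<close>)
  also have "\<dots> = mat_trace (A * A\<^sup>\<dagger>) + mat_trace (D * D\<^sup>\<dagger>)"
    unfolding MY by (rule mat_trace_block_diag) (use A D in \<open>auto intro!: carrier_matI\<close>)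
  also have "\<dots> = of_nat (mrank A + mrank D)" by (simp add: mrank_mp)
  finally show ?thesis by (simp only: of_nat_eq_iff)
qed

text \<open>Blocks without rows turn the row block into a block matrix to which the block multiplication
  rule applies.\<close>

lemma row_block_eq_four_block:
  assumes "A \<in> carrier_mat m n" "B \<in> carrier_mat m k"
  shows "row_block A B = four_block_mat A B (0\<^sub>m 0 n) (0\<^sub>m 0 k)"
  by (rule eq_matI) (use assms in \<open>auto simp: row_block_def mat_of_cols_def nth_append\<close>)

text \<open>The column space of \<open>[A, B]\<close> is the orthogonal sum of that of \<open>B\<close> and that of the
  part \<open>E\<^sub>B A\<close> of \<open>A\<close> orthogonal to it, so the projections add up.\<close>

lemma mrank_row_block:
  assumes A: "A \<in> carrier_mat m k" and B: "B \<in> carrier_mat m n"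
  shows "mrank (row_block A B) = mrank B + mrank (E_proj B * A)"
proof -
  define D where "D = E_proj B * A"
  have D: "D \<in> carrier_mat m k" using A B by (auto simp: D_def intro!: carrier_matI)
  note d = carrier_matD[OF A] carrier_matD[OF B] carrier_matD[OF D]
  have ED: "E_proj B * D = D" by (simp add: D_def mat_simps d)
  have BD: "B\<^sup>\<dagger> * D = 0\<^sub>m n k" by (simp add: D_def mat_simps d)
  have "D\<^sup>H * (D * D\<^sup>\<dagger>) * B = A\<^sup>H * (E_proj B * B)"
    unfolding mp_mult_adjoint(1) by (simp add: D_def mat_simps d)
  then have "D\<^sup>H * B = 0\<^sub>m k n"
    by (simp add: mp_mult_adjoint mat_simps d)
  then have DB: "D\<^sup>\<dagger> * B = 0\<^sub>m k n"
  proof -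
    assume *: "D\<^sup>H * B = 0\<^sub>m k n"
    have "D\<^sup>\<dagger> * B = D\<^sup>\<dagger> * ((D\<^sup>\<dagger>)\<^sup>H * (D\<^sup>H * B))" by (simp add: mat_simps d)
    then show ?thesis unfolding * by (simp add: mat_simps d)
  qed
  have AD: "D = A - B * (B\<^sup>\<dagger> * A)" by (simp add: D_def E_proj_def mat_simps d)
  have DA: "D * (D\<^sup>\<dagger> * A) = D"
  proof -
    have "D * (D\<^sup>\<dagger> * D) = D * (D\<^sup>\<dagger> * A) - D * (D\<^sup>\<dagger> * (B * (B\<^sup>\<dagger> * A)))"
      by (subst (3) AD) (simp add: mat_simps d)
    then show ?thesis
      by (simp add: mp_mult mult_chain[OF DB] mat_simps d)
  qed
  let ?X = "four_block_mat A B (0\<^sub>m 0 k) (0\<^sub>m 0 n)"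
  \<comment> \<open>Chosen such that \<open>?X * ?Y\<close> is the projection \<open>D D\<^sup>\<dagger> + B B\<^sup>\<dagger>\<close> onto the column space of \<open>?X\<close>.\<close>
  let ?Y = "four_block_mat (D\<^sup>\<dagger>) (0\<^sub>m k 0) (B\<^sup>\<dagger> - B\<^sup>\<dagger> * A * D\<^sup>\<dagger>) (0\<^sub>m n 0)"
  have sum1: "A * D\<^sup>\<dagger> + (B * B\<^sup>\<dagger> - B * (B\<^sup>\<dagger> * (A * D\<^sup>\<dagger>))) = D * D\<^sup>\<dagger> + B * B\<^sup>\<dagger>"
  proof -
    have "D * D\<^sup>\<dagger> = A * D\<^sup>\<dagger> - B * (B\<^sup>\<dagger> * (A * D\<^sup>\<dagger>))"
      by (subst AD) (simp add: mat_simps d)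
    then show ?thesis using d by (auto intro!: eq_matI simp del: index_mult_mat(1))
  qed
  have XY: "?X * ?Y = four_block_mat (D * D\<^sup>\<dagger> + B * B\<^sup>\<dagger>) (0\<^sub>m m 0) (0\<^sub>m 0 m) (0\<^sub>m 0 0)"
    by (simp add: mat_simps d sum1)
  have "(D * D\<^sup>\<dagger> + B * B\<^sup>\<dagger>) * A = D + B * (B\<^sup>\<dagger> * A)"
    using DA by (simp add: mat_simps d)
  also have "\<dots> = A"
    unfolding AD using d by (auto intro!: eq_matI simp del: index_mult_mat(1))
  finally have TA: "(D * D\<^sup>\<dagger> + B * B\<^sup>\<dagger>) * A = A" .
  have TB: "(D * D\<^sup>\<dagger> + B * B\<^sup>\<dagger>) * B = B"
    by (simp add: mat_simps d DB)
  have "of_nat (mrank ?X) = mat_trace (?X * ?Y)"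
  proof (rule mrank_eq_trace[of _ "m + 0" "k + n"])
    show "?X * ?Y * ?X = ?X"
      unfolding XY by (subst mult_four_block_dim) (simp_all add: d TA TB mat_simps)
  qed (use A B D in \<open>auto intro!: carrier_matI\<close>)
  also have "\<dots> = mat_trace (D * D\<^sup>\<dagger> + B * B\<^sup>\<dagger>) + mat_trace (0\<^sub>m 0 0)"
    unfolding XY by (rule mat_trace_block_diag) (use A B D in \<open>auto intro!: carrier_matI\<close>)
  also have "\<dots> = mat_trace (D * D\<^sup>\<dagger>) + mat_trace (B * B\<^sup>\<dagger>)"
    by (subst mat_trace_add[of _ m]) (use A B D in \<open>auto intro!: carrier_matI simp: mat_trace_def\<close>)
  also have "\<dots> = of_nat (mrank B + mrank D)" by (simp add: mrank_mp)
  finally show ?thesis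
    unfolding row_block_eq_four_block[OF A B] D_def by (simp only: of_nat_eq_iff)
qed

section \<open>Inertia\<close>

lemma order_prod_linear:
  "Polynomial.order (x::complex) (\<Prod>a\<leftarrow>as. [:- a, 1:]) = length (filter (\<lambda>a. a = x) as)"
proof (induction as)
  case (Cons a as)
  have "(\<Prod>a\<leftarrow>as. [:- a, 1:]) \<noteq> 0" unfolding prod_list_zero_iff by auto
  then have "[:- a, 1:] * (\<Prod>a\<leftarrow>as. [:- a, 1:]) \<noteq> 0"
    by (intro no_zero_divisors) simp
  from order_mult[OF this, of x] Cons show ?case
    by (simp add: order_linear' del: mult_pCons_left)
qed auto

lemma order_char_poly_spectral:
  assumes U: "unitary_mat n U" and H: "H = U * real_diag n d * U\<^sup>H"
  shows "Polynomial.order (of_real x) (char_poly H) = card {i. i < n \<and> d i = x}"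
proof -
  have UC: "U \<in> carrier_mat n n" "U\<^sup>H * U = 1\<^sub>m n" "U * U\<^sup>H = 1\<^sub>m n"
    using U by (auto simp: unitary_mat_def)
  have HC: "H \<in> carrier_mat n n" using UC unfolding H by (auto intro!: carrier_matI)
  have "similar_mat_wit H (real_diag n d) U U\<^sup>H"
    using UC HC H by (intro similar_mat_witI[of _ _ n]) auto
  then have "char_poly H = char_poly (real_diag n d)"
    by (intro char_poly_similar) (auto simp: similar_mat_def)
  also have "\<dots> = (\<Prod>a\<leftarrow>diag_mat (real_diag n d). [:- a, 1:])"
    by (rule char_poly_upper_triangular[of _ n]) (auto simp: upper_triangular_def)
  also have "diag_mat (real_diag n d) = map (\<lambda>i. of_real (d i)) [0..<n]"
    by (auto simp: diag_mat_def)
  finally have cp: "char_poly H = (\<Prod>a\<leftarrow>map (\<lambda>i. of_real (d i)) [0..<n]. [:- a, 1:])" .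
  have "Polynomial.order (of_real x) (char_poly H) = length (filter (\<lambda>i. d i = x) [0..<n])"
    unfolding cp order_prod_linear by (simp add: filter_map o_def)
  also have "\<dots> = card {i. i < n \<and> d i = x}"
    by (subst distinct_length_filter) (auto intro!: arg_cong[where f = card])
  finally show ?thesis .
qed

lemma spectral_eigenvalue_count:
  fixes S :: "real \<Rightarrow> bool"
  assumes U: "unitary_mat n U" and H: "H = U * real_diag n d * U\<^sup>H"
  shows "(\<Sum>x | S x \<and> eigenvalue H (complex_of_real x). Polynomial.order (complex_of_real x) (char_poly H))
    = card {i. i < n \<and> S (d i)}"
proof -
  have HC: "H \<in> carrier_mat n n" using U unfolding H by (auto simp: unitary_mat_def intro!: carrier_matI)
  note ord = order_char_poly_spectral[OF U H]
  have p0: "char_poly H \<noteq> 0" using degree_monic_char_poly[OF HC] by auto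
  have ev: "eigenvalue H (complex_of_real x) \<longleftrightarrow> x \<in> d ` {..<n}" for x
  proof -
    have "eigenvalue H (complex_of_real x) \<longleftrightarrow> card {i. i < n \<and> d i = x} \<noteq> 0"
      unfolding eigenvalue_root_char_poly[OF HC] order_root ord using p0 by simp
    then show ?thesis by auto
  qed
  define T where "T = {i. i < n \<and> S (d i)}"
  have "card T = (\<Sum>x\<in>d ` T. card {i \<in> T. d i = x})"
    using sum.image_gen[of T "\<lambda>_. 1::nat" d] by (simp add: T_def)
  also have "d ` T = {x. S x \<and> eigenvalue H (complex_of_real x)}"
    unfolding ev T_def by auto
  also have "(\<Sum>x | S x \<and> eigenvalue H (complex_of_real x). card {i \<in> T. d i = x})
      = (\<Sum>x | S x \<and> eigenvalue H (complex_of_real x). card {i. i < n \<and> d i = x})"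
    by (intro sum.cong refl arg_cong[where f = card]) (auto simp: T_def)
  finally show ?thesis by (simp add: T_def ord)
qed

lemma mrank_unitary_diag:
  assumes U: "unitary_mat n U"
  shows "mrank (U * real_diag n e) = card {i. i < n \<and> e i \<noteq> 0}"
proof -
  have UC: "U \<in> carrier_mat n n" "U\<^sup>H * U = 1\<^sub>m n" "U * U\<^sup>H = 1\<^sub>m n"
    using U by (auto simp: unitary_mat_def)
  note d = carrier_matD[OF UC(1)]
  let ?A = "U * real_diag n e" and ?Y = "real_diag n (\<lambda>i. inverse (e i)) * U\<^sup>H"
  have e: "(\<lambda>i. e i * (inverse (e i) * e i)) = e"
    by (rule ext, case_tac "e i = 0") auto
  have AC: "?A \<in> carrier_mat n n" "?Y \<in> carrier_mat n n" using UC by auto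
  have YA: "?Y * ?A = real_diag n (\<lambda>i. inverse (e i) * e i)"
    by (simp add: mat_simps d mult_chain[OF UC(2)])
  have "of_nat (mrank ?A) = mat_trace (?A * ?Y)"
  proof (rule mrank_eq_trace[OF AC])
    have "?A * ?Y * ?A = ?A * (?Y * ?A)" using AC by simp
    also have "\<dots> = ?A" unfolding YA by (simp add: mat_simps d e)
    finally show "?A * ?Y * ?A = ?A" .
  qed
  also have "\<dots> = mat_trace (?Y * ?A)" by (rule mat_trace_comm[OF AC])
  also have "\<dots> = (\<Sum>i<n. of_nat (if e i \<noteq> 0 then 1 else 0))"
    unfolding YA by (auto simp: mat_trace_def intro!: sum.cong)
  also have "\<dots> = of_nat (card {i. i < n \<and> e i \<noteq> 0})"
    unfolding of_nat_sum[symmetric]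
    by (simp add: sum.If_cases Int_def conj_commute)
  finally show ?thesis by (simp only: of_nat_eq_iff)
qed

lemma uminus_hermitian: "H \<in> hermitian_mats n \<Longrightarrow> - H \<in> hermitian_mats n"
  by (auto simp: hermitian_mats_def mat_simps)

lemma i_minus_eq_i_plus_uminus:
  assumes "H \<in> hermitian_mats n"
  shows "i_minus H = i_plus (- H)"
proof -
  obtain U d where U: "unitary_mat n U" and H: "H = U * real_diag n d * U\<^sup>H"
    using spectral_decomposition[OF assms] by blast
  have UC: "U \<in> carrier_mat n n" using U by (auto simp: unitary_mat_def)
  have "real_diag n (\<lambda>i. - d i) = - real_diag n d" by (rule eq_matI) auto
  then have mH: "- H = U * real_diag n (\<lambda>i. - d i) * U\<^sup>H"
    unfolding H using UC by (simp add: mat_simps)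
  show ?thesis
    unfolding i_minus_def i_plus_def spectral_eigenvalue_count[OF U H] spectral_eigenvalue_count[OF U mH]
    by simp
qed

text \<open>Split the eigenvalues by sign: \<open>P P\<^sup>H\<close> and \<open>G G\<^sup>H\<close> are the positive and the negative part of
  \<open>H\<close>, and \<open>Q\<close> selects the eigenvectors with positive eigenvalue.\<close>

lemma inertia_factors:
  assumes "H \<in> hermitian_mats n"
  shows "\<exists>P G Q. P \<in> carrier_mat n n \<and> G \<in> carrier_mat n n \<and> Q \<in> carrier_mat n n \<and>
    H = P * P\<^sup>H - G * G\<^sup>H \<and> mrank P = i_plus H \<and>
    pos_semidef (Q\<^sup>H * H * Q) \<and> mrank (Q\<^sup>H * H * Q) = i_plus H"
proof -
  obtain U d where U: "unitary_mat n U" and H: "H = U * real_diag n d * U\<^sup>H"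
    using spectral_decomposition[OF assms] by blast
  have UC: "U \<in> carrier_mat n n" "U\<^sup>H * U = 1\<^sub>m n" "U * U\<^sup>H = 1\<^sub>m n"
    using U by (auto simp: unitary_mat_def)
  note dm = carrier_matD[OF UC(1)]
  define p where "p i = sqrt (max (d i) 0)" for i
  define g where "g i = sqrt (max (- d i) 0)" for i
  define q where "q i = (if 0 < d i then 1 else 0 :: real)" for i
  define P where "P = U * real_diag n p"
  define G where "G = U * real_diag n g"
  define Q where "Q = U * real_diag n q"
  have c: "P \<in> carrier_mat n n" "G \<in> carrier_mat n n" "Q \<in> carrier_mat n n"
    using UC by (auto simp: P_def G_def Q_def)
  have ip: "i_plus H = card {i. i < n \<and> 0 < d i}"
    unfolding i_plus_def by (rule spectral_eigenvalue_count[OF U H])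
  have pg: "p i * p i - g i * g i = d i" for i
    by (auto simp: p_def g_def max_def)
  have "P * P\<^sup>H - G * G\<^sup>H = U * ((real_diag n (\<lambda>i. p i * p i) - real_diag n (\<lambda>i. g i * g i)) * U\<^sup>H)"
    by (simp add: P_def G_def mat_simps dm mult_chain[OF real_diag_mult])
  also have "real_diag n (\<lambda>i. p i * p i) - real_diag n (\<lambda>i. g i * g i) = real_diag n d"
    by (rule eq_matI) (auto simp flip: pg)
  finally have HPG: "H = P * P\<^sup>H - G * G\<^sup>H" unfolding H by (simp add: mat_simps dm)
  have rP: "mrank P = i_plus H"
    unfolding P_def mrank_unitary_diag[OF U] ip
    by (intro arg_cong[where f = card]) (auto simp: p_def max_def)
  have qdq: "(\<lambda>i. q i * d i * q i) = (\<lambda>i. p i * p i)"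
    by (auto simp: q_def p_def max_def)
  have QHQ: "Q\<^sup>H * H * Q = real_diag n p * (real_diag n p)\<^sup>H"
    by (simp add: Q_def H mat_simps dm mult_chain[OF UC(2)] mult_chain[OF real_diag_mult] UC(2) qdq)
  have one: "unitary_mat n (1\<^sub>m n)" by (auto simp: unitary_mat_def mat_simps)
  have "Q\<^sup>H * H * Q = 1\<^sub>m n * real_diag n (\<lambda>i. p i * p i)"
    unfolding QHQ by (simp add: mat_simps)
  then have "mrank (Q\<^sup>H * H * Q) = card {i. i < n \<and> p i * p i \<noteq> 0}"
    using mrank_unitary_diag[OF one] by metis
  also have "\<dots> = i_plus H"
    unfolding ip by (intro arg_cong[where f = card]) (auto simp: p_def max_def)
  finally have "mrank (Q\<^sup>H * H * Q) = i_plus H" .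
  moreover have "pos_semidef (Q\<^sup>H * H * Q)"
    unfolding QHQ by (rule pos_semidef_gram) (rule real_diag_dim)
  ultimately show ?thesis using c HPG rP by blast
qed

text \<open>This inequality contains Sylvester's law of inertia. With \<open>R = Q\<^sup>H P\<close>, the matrix
  \<open>R R\<^sup>H\<close> is \<open>Q\<^sup>H H Q\<close> plus a Gram matrix; so the kernel of \<open>R\<^sup>H\<close> annihilates \<open>Q\<^sup>H H Q = V V\<^sup>H\<close>,
  whose column space therefore lies in that of \<open>R\<close>.\<close>

lemma psd_section_rank_le:
  assumes P: "P \<in> carrier_mat n p" and G: "G \<in> carrier_mat n q" and Q: "Q \<in> carrier_mat n k"
    and H: "H = P * P\<^sup>H - G * G\<^sup>H" and psd: "pos_semidef (Q\<^sup>H * H * Q)"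
  shows "mrank (Q\<^sup>H * H * Q) \<le> mrank P"
proof -
  define R where "R = Q\<^sup>H * P"
  define T where "T = Q\<^sup>H * G"
  have R: "R \<in> carrier_mat k p" and T: "T \<in> carrier_mat k q"
    using P Q G by (auto simp: R_def T_def)
  obtain V where V: "V \<in> carrier_mat k k" "Q\<^sup>H * H * Q = V * V\<^sup>H"
    using pos_semidef_factor[OF psd, of k] Q by auto
  note d = carrier_matD[OF P] carrier_matD[OF G] carrier_matD[OF Q] carrier_matD[OF R]
    carrier_matD[OF T] carrier_matD[OF V(1)]
  have "V * V\<^sup>H = R * R\<^sup>H - T * T\<^sup>H"
    unfolding V(2)[symmetric] H R_def T_def by (simp add: mat_simps d)
  then have VT: "V * V\<^sup>H + T * T\<^sup>H = R * R\<^sup>H"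
    using d by (auto intro!: eq_matI simp del: index_mult_mat(1))
  define Z where "Z = 1\<^sub>m k - R * R\<^sup>\<dagger>"
  have Z: "Z \<in> carrier_mat k k" "Z\<^sup>H = Z" using R by (auto simp: Z_def mat_simps intro!: carrier_matI)
  note d = d carrier_matD[OF Z(1)]
  have ZR: "Z * R = 0\<^sub>m k p" by (auto simp: Z_def mat_simps d)
  have "(V\<^sup>H * Z)\<^sup>H * (V\<^sup>H * Z) + (T\<^sup>H * Z)\<^sup>H * (T\<^sup>H * Z) = Z * (V * V\<^sup>H + T * T\<^sup>H) * Z"
    using Z(2) by (simp add: mat_simps d)
  also have "\<dots> = 0\<^sub>m k k"
    unfolding VT by (simp add: mat_simps d mult_chain[OF ZR])
  finally have "V\<^sup>H * Z = 0\<^sub>m k k"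
    by (rule gram_sum_eq_zero[rotated 2]) (use V T Z in auto)
  from arg_cong[OF this, of mat_adjoint] have "Z * V = 0\<^sub>m k k"
    using Z(2) by (simp add: mat_simps d)
  then have "V - R * R\<^sup>\<dagger> * V = 0\<^sub>m k k" by (simp add: Z_def mat_simps d)
  then have RV: "R * R\<^sup>\<dagger> * V = V"
    by (subst (asm) minus_eq_zero_mat_iff) (use V R in \<open>auto intro!: carrier_matI\<close>)
  have "mrank (V * V\<^sup>H) \<le> mrank V"
    by (rule mrank_mult_left[of _ k k _ k]) (use V in auto)
  also have "\<dots> \<le> mrank R" by (rule column_space_rank(1)[OF V(1) R RV])
  also have "\<dots> \<le> mrank P"
    unfolding R_def by (rule mrank_mult_right[of _ k n _ p]) (use P Q in auto)
  finally show ?thesis unfolding V(2) .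
qed

text \<open>Both bounds come from comparing the given data with those of the spectral decomposition.\<close>

lemma i_plus_eqI:
  assumes HH: "H \<in> hermitian_mats n"
    and P: "P \<in> carrier_mat n p" and G: "G \<in> carrier_mat n q" and Q: "Q \<in> carrier_mat n k"
    and H: "H = P * P\<^sup>H - G * G\<^sup>H" and psd: "pos_semidef (Q\<^sup>H * H * Q)"
    and r: "mrank P \<le> r" "r \<le> mrank (Q\<^sup>H * H * Q)"
  shows "i_plus H = r"
proof -
  obtain P' G' Q' where c: "P' \<in> carrier_mat n n" "G' \<in> carrier_mat n n" "Q' \<in> carrier_mat n n"
    and H': "H = P' * P'\<^sup>H - G' * G'\<^sup>H" "mrank P' = i_plus H"
    "pos_semidef (Q'\<^sup>H * H * Q')" "mrank (Q'\<^sup>H * H * Q') = i_plus H"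
    using inertia_factors[OF HH] by blast
  have "i_plus H \<le> mrank P"
    using psd_section_rank_le[OF P G c(3) H H'(3)] H'(4) by simp
  moreover have "mrank (Q\<^sup>H * H * Q) \<le> i_plus H"
    using psd_section_rank_le[OF c(1,2) Q H'(1) psd] H'(2) by simp
  ultimately show ?thesis using r by simp
qed

lemma i_plus_eq_0_iff:
  assumes HH: "H \<in> hermitian_mats n"
  shows "i_plus H = 0 \<longleftrightarrow> pos_semidef (- H)"
proof
  have HC: "H \<in> carrier_mat n n" using HH by (auto simp: hermitian_mats_def)
  {
    assume "i_plus H = 0"
    then obtain P G where c: "P \<in> carrier_mat n n" "G \<in> carrier_mat n n"
      and H: "H = P * P\<^sup>H - G * G\<^sup>H" "mrank P = 0"
      using inertia_factors[OF HH] by auto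
    have "P = 0\<^sub>m n n" using mrank_eq_0[OF c(1) H(2)] .
    then have "- H = G * G\<^sup>H" unfolding H(1) using c by (simp add: mat_simps)
    then show "pos_semidef (- H)" using pos_semidef_gram[OF c(2)] by simp
  }
  assume "pos_semidef (- H)"
  then obtain G where G: "G \<in> carrier_mat n n" "- H = G * G\<^sup>H"
    using pos_semidef_factor[of "- H" n] HC by auto
  have "H = - (G * G\<^sup>H)" unfolding G(2)[symmetric] by simp
  then have "H = 0\<^sub>m n n * (0\<^sub>m n n)\<^sup>H - G * G\<^sup>H"
    using G by (simp add: mat_simps)
  moreover have "pos_semidef ((0\<^sub>m n n)\<^sup>H * H * 0\<^sub>m n n)"
    using pos_semidef_gram[of "0\<^sub>m n n" n n] HC by (simp add: mat_simps)
  ultimately show "i_plus H = 0"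
    by (intro i_plus_eqI[OF HH zero_carrier_mat G(1) zero_carrier_mat])
       (simp_all add: vec_space.rank_0I)
qed

text \<open>\<open>W W\<^sup>H\<close> and \<open>W\<close> have the same column space, because \<open>W W\<^sup>H Z = 0\<close> implies \<open>W\<^sup>H Z = 0\<close>.\<close>

lemma psd_gram_rank:
  assumes W: "W \<in> carrier_mat n n"
  shows "mrank (W * W\<^sup>H) = mrank W"
proof (rule antisym)
  show "mrank (W * W\<^sup>H) \<le> mrank W"
    by (rule mrank_mult_left[of _ n n _ n]) (use W in auto)
  define H where "H = W * W\<^sup>H"
  have H: "H \<in> carrier_mat n n" "H\<^sup>H = H" using W by (auto simp: H_def mat_simps)
  note d = carrier_matD[OF W] carrier_matD[OF H(1)]
  define Z where "Z = 1\<^sub>m n - H * H\<^sup>\<dagger>"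
  have Z: "Z \<in> carrier_mat n n" "Z\<^sup>H = Z" using d by (auto simp: Z_def mat_simps intro!: carrier_matI)
  note d = d carrier_matD[OF Z(1)]
  have "H * Z = 0\<^sub>m n n"
    unfolding Z_def mp_hermitian(2)[OF H(2), symmetric] by (auto simp: mat_simps d)
  then have "(W\<^sup>H)\<^sup>H * (W\<^sup>H * Z) = 0\<^sub>m n n" by (simp add: H_def mat_simps d)
  then have "W\<^sup>H * Z = 0\<^sub>m n n" by (rule gram_cancel[OF adjoint_carrier[OF W] Z(1)])
  from arg_cong[OF this, of mat_adjoint] have "Z * W = 0\<^sub>m n n"
    using Z(2) by (simp add: mat_simps d)
  then have "W - H * H\<^sup>\<dagger> * W = 0\<^sub>m n n" by (simp add: Z_def mat_simps d)
  then have "H * H\<^sup>\<dagger> * W = W"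
    by (subst (asm) minus_eq_zero_mat_iff) (use W H in \<open>auto intro!: carrier_matI\<close>)
  then show "mrank W \<le> mrank (W * W\<^sup>H)"
    unfolding H_def[symmetric] by (rule column_space_rank(1)[OF W H(1)])
qed

lemma i_plus_psd:
  assumes psd: "pos_semidef H" and n: "dim_row H = n"
  shows "i_plus H = mrank H"
proof -
  obtain W where W: "W \<in> carrier_mat n n" "H = W * W\<^sup>H"
    using pos_semidef_factor[OF assms] by blast
  have HH: "H \<in> hermitian_mats n" using psd n by (auto simp: pos_semidef_def)
  have HC: "H \<in> carrier_mat n n" using HH by (auto simp: hermitian_mats_def)
  have 1: "H = W * W\<^sup>H - 0\<^sub>m n n * (0\<^sub>m n n)\<^sup>H" using W by (simp add: mat_simps)
  have 2: "(1\<^sub>m n)\<^sup>H * H * 1\<^sub>m n = H" using HC by (simp add: mat_simps)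
  have 3: "mrank W = mrank H" unfolding W(2) by (rule psd_gram_rank[OF W(1), symmetric])
  show ?thesis
  proof (rule i_plus_eqI[OF HH W(1) zero_carrier_mat one_carrier_mat 1])
    show "pos_semidef ((1\<^sub>m n)\<^sup>H * H * 1\<^sub>m n)" unfolding 2 by (rule psd)
    show "mrank W \<le> mrank H" unfolding 3 ..
    show "mrank H \<le> mrank ((1\<^sub>m n)\<^sup>H * H * 1\<^sub>m n)" unfolding 2 ..
  qed
qed

subsection \<open>Inertia of a bordered matrix\<close>

lemma smult_mult_dim [mat_simps]:
  fixes A B :: "complex mat"
  assumes "dim_col A = dim_row B"
  shows "(c \<cdot>\<^sub>m A) * B = c \<cdot>\<^sub>m (A * B)" "A * (c \<cdot>\<^sub>m B) = c \<cdot>\<^sub>m (A * B)"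
  using assms by (auto intro!: mult_smult_assoc_mat[of A "dim_row A" "dim_col A" B "dim_col B"]
    mult_smult_distrib[of A "dim_row A" "dim_col A" B "dim_col B"])

lemma minus_self_dim:
  fixes A :: "'a::group_add mat"
  shows "A + - A = 0\<^sub>m (dim_row A) (dim_col A)"
  by (rule eq_matI) auto

lemma half_add_half: "(1/2) \<cdot>\<^sub>m A + (1/2) \<cdot>\<^sub>m A = (A :: complex mat)"
  by (rule eq_matI) auto

lemma minus_four_block_dim:
  fixes A1 B1 C1 D1 :: "complex mat"
  assumes "dim_row B1 = dim_row A1" "dim_col C1 = dim_col A1" "dim_row D1 = dim_row C1"
    "dim_col D1 = dim_col B1"
    "dim_row A2 = dim_row A1" "dim_col A2 = dim_col A1" "dim_row B2 = dim_row B1" "dim_col B2 = dim_col B1"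
    "dim_row C2 = dim_row C1" "dim_col C2 = dim_col C1" "dim_row D2 = dim_row D1" "dim_col D2 = dim_col D1"
  shows "four_block_mat A1 B1 C1 D1 - four_block_mat A2 B2 C2 D2
    = four_block_mat (A1 - A2) (B1 - B2) (C1 - C2) (D1 - D2)"
  by (rule eq_matI) (use assms in auto)

text \<open>As \<open>A - N\<close> has the form \<open>B Z + Z\<^sup>H B\<^sup>H\<close>, a block triangular congruence replaces \<open>A\<close> by \<open>N = E A E\<close>
  in the bordered matrix. The form of the new matrix at \<open>(x, y)\<close> is \<open>x\<^sup>H N x + 2 Re (x\<^sup>H B y)\<close>. Its second
  summand is \<open>|S x + B y / 2|\<^sup>2 - |S x - B y / 2|\<^sup>2\<close> with \<open>S = B B\<^sup>\<dagger>\<close>, which contributes \<open>r(B)\<close> positive and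
  \<open>r(B)\<close> negative directions, independent of those of \<open>N\<close> because \<open>E\<close> and \<open>S\<close> are complementary.\<close>

lemma i_plus_bordered:
  assumes A: "A \<in> hermitian_mats m" and B: "B \<in> carrier_mat m n"
  shows "i_plus (four_block_mat A B (B\<^sup>H) (0\<^sub>m n n)) = mrank B + i_plus (E_proj B * A * E_proj B)"
proof -
  define E where "E = E_proj B"
  define N where "N = E * A * E"
  define S where "S = B * B\<^sup>\<dagger>"
  have AC: "A \<in> carrier_mat m m" "A\<^sup>H = A" using A by (auto simp: hermitian_mats_def)
  have EC: "E \<in> carrier_mat m m" and SC: "S \<in> carrier_mat m m"
    using B by (auto simp: E_def S_def intro!: carrier_matI)
  note d = carrier_matD[OF AC(1)] carrier_matD[OF B] carrier_matD[OF EC] carrier_matD[OF SC]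
  have NH: "N \<in> hermitian_mats m" using AC
    by (auto simp: N_def hermitian_mats_def E_def mat_simps d intro!: carrier_matI)
  have NC: "N \<in> carrier_mat m m" "N\<^sup>H = N" using NH by (auto simp: hermitian_mats_def)
  obtain P G Q where c: "P \<in> carrier_mat m m" "G \<in> carrier_mat m m" "Q \<in> carrier_mat m m"
    and NPG: "N = P * P\<^sup>H - G * G\<^sup>H" and rP: "mrank P = i_plus N"
    and psd: "pos_semidef (Q\<^sup>H * N * Q)" and rQ: "mrank (Q\<^sup>H * N * Q) = i_plus N"
    using inertia_factors[OF NH] by blast
  note d = d carrier_matD[OF NC(1)] carrier_matD[OF c(1)] carrier_matD[OF c(2)] carrier_matD[OF c(3)]
  define J where "J = (1/2) \<cdot>\<^sub>m B\<^sup>H"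
  define T where "T = (1/2) \<cdot>\<^sub>m B\<^sup>\<dagger>"
  define Z where "Z = B\<^sup>\<dagger> * A - (1/2) \<cdot>\<^sub>m (B\<^sup>\<dagger> * (A * S))"
  have dj [simp]: "dim_row J = n" "dim_col J = m" "dim_row T = n" "dim_col T = m"
    "dim_row Z = n" "dim_col Z = m"
    by (auto simp: J_def T_def Z_def d)
  have S: "S\<^sup>H = S" "S * S = S" "S * B = B" "B\<^sup>H * S = B\<^sup>H" "E * S = 0\<^sub>m m m" "S * E = 0\<^sub>m m m"
    by (auto simp: S_def E_def mat_simps d)
  have E: "E\<^sup>H = E" "E * E = E" "E * B = 0\<^sub>m m n" "B\<^sup>H * E = 0\<^sub>m n m"
    by (auto simp: E_def mat_simps d)
  have N: "E * N = N" "N * E = N" "S * N = 0\<^sub>m m m" "N * S = 0\<^sub>m m m"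
    by (auto simp: N_def mat_simps d S E mult_chain[OF E(2)] mult_chain[OF S(6)])
  have J: "J\<^sup>H + J\<^sup>H = B" "J + J = B\<^sup>H" "J * S = J" "S * J\<^sup>H = J\<^sup>H"
    by (auto simp: J_def mat_simps d S half_add_half)
  have T: "T\<^sup>H * B\<^sup>H + B * T = S"
    by (simp add: T_def mat_simps d half_add_half S_def)
  define M0 where "M0 = four_block_mat N B (B\<^sup>H) (0\<^sub>m n n)"
  define C where "C = four_block_mat (1\<^sub>m m) (Z\<^sup>H) (0\<^sub>m n m) (1\<^sub>m n)"
  define C' where "C' = four_block_mat (1\<^sub>m m) (- Z\<^sup>H) (0\<^sub>m n m) (1\<^sub>m n)"
  define M where "M = four_block_mat A B (B\<^sup>H) (0\<^sub>m n n)"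
  have dC [simp]: "dim_row C = m + n" "dim_col C = m + n" "dim_row C' = m + n" "dim_col C' = m + n"
    "dim_row M = m + n" "dim_col M = m + n" "dim_row M0 = m + n" "dim_col M0 = m + n"
    by (auto simp: C_def C'_def M_def M0_def d)
  have CC: "C' * C = 1\<^sub>m (m + n)"
    by (simp add: C_def C'_def mat_simps d minus_self_dim)
  have ZA: "N + Z\<^sup>H * B\<^sup>H + B * Z = A"
  proof -
    have 1: "B * Z = S * A - (1/2) \<cdot>\<^sub>m (S * (A * S))"
      by (simp add: Z_def S_def mat_simps d)
    have 2: "Z\<^sup>H * B\<^sup>H = A * S - (1/2) \<cdot>\<^sub>m (S * (A * S))"
      using arg_cong[OF 1, of mat_adjoint] by (simp add: mat_simps d S AC)
    have 3: "N = A - S * A - (A * S - S * (A * S))"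
      by (simp add: N_def E_def E_proj_def S_def mat_simps d)
    show ?thesis unfolding 1 2 3
      using d by (intro eq_matI) (simp_all del: index_mult_mat(1))
  qed
  have MC: "M = C * M0 * C\<^sup>H"
    using ZA by (simp add: M_def M0_def C_def mat_simps d)
  \<comment> \<open>\<open>P0\<close> and \<open>G0\<close> hold the two squares (\<open>J = B\<^sup>H / 2\<close>); \<open>Q0\<close> spans a subspace on which the form
    is \<open>Q\<^sup>H N Q\<close> plus the projection \<open>S\<close>.\<close>
  define P0 where "P0 = four_block_mat P S (0\<^sub>m n m) J"
  define G0 where "G0 = four_block_mat G S (0\<^sub>m n m) (- J)"
  define Q0 where "Q0 = four_block_mat (E * Q) S (0\<^sub>m n m) T"
  have dP [simp]: "dim_row P0 = m + n" "dim_col P0 = m + m" "dim_row G0 = m + n" "dim_col G0 = m + m"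
    "dim_row Q0 = m + n" "dim_col Q0 = m + m"
    by (auto simp: P0_def G0_def Q0_def d)
  have MPG0: "M0 = P0 * P0\<^sup>H - G0 * G0\<^sup>H"
  proof -
    have "N = P * P\<^sup>H + S - (G * G\<^sup>H + S)"
      unfolding NPG using d by (intro eq_matI) (simp_all del: index_mult_mat(1))
    moreover have "J\<^sup>H - - J\<^sup>H = B" "J - - J = B\<^sup>H" "J * J\<^sup>H - J * J\<^sup>H = 0\<^sub>m n n"
      using J(1,2) by (auto intro!: eq_matI simp del: index_mult_mat(1))
    ultimately show ?thesis
      by (simp add: M0_def P0_def G0_def mat_simps d S J minus_four_block_dim)
  qed
  have QMQ0: "Q0\<^sup>H * M0 * Q0 = four_block_mat (Q\<^sup>H * N * Q) (0\<^sub>m m m) (0\<^sub>m m m) S"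
  proof -
    have "S * (B * T) = B * T" using mult_chain[OF S(3), of T] d by simp
    then show ?thesis
      using T by (simp add: Q0_def M0_def mat_simps d S E N mult_chain[OF E(4)] mult_chain[OF E(3)]
        mult_chain[OF N(1)] mult_chain[OF N(2)] mult_chain[OF N(3)] mult_chain[OF S(6)] mult_chain[OF S(5)])
  qed
  have MPG: "M = (C * P0) * (C * P0)\<^sup>H - (C * G0) * (C * G0)\<^sup>H"
    unfolding MC MPG0 by (simp add: mat_simps)
  have CC': "C\<^sup>H * C'\<^sup>H = 1\<^sub>m (m + n)"
    using arg_cong[OF CC, of mat_adjoint] by (simp add: mat_simps)
  have QMQ: "(C'\<^sup>H * Q0)\<^sup>H * M * (C'\<^sup>H * Q0) = Q0\<^sup>H * M0 * Q0"
    unfolding MC by (simp add: mat_simps mult_chain[OF CC] mult_chain[OF CC'])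
  have rS: "mrank S = mrank B"
  proof -
    have "of_nat (mrank S) = mat_trace (S * 1\<^sub>m m)"
      by (rule mrank_eq_trace[OF SC]) (simp_all add: mat_simps d S)
    also have "\<dots> = of_nat (mrank B)" unfolding mrank_mp by (simp add: S_def mat_simps d)
    finally show ?thesis by simp
  qed
  \<comment> \<open>Factoring out a block diagonal matrix bounds the rank by \<open>i_plus N + r(B)\<close>.\<close>
  have "mrank (C * P0) \<le> mrank P0"
    by (rule mrank_mult_right[of _ "m + n" "m + n" _ "m + m"]) (auto intro!: carrier_matI)
  also have "mrank P0 = mrank (four_block_mat (1\<^sub>m m) S (0\<^sub>m n m) J * four_block_mat P (0\<^sub>m m m) (0\<^sub>m m m) S)"
    by (rule arg_cong[where f = mrank]) (simp add: P0_def mat_simps d S J)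
  also have "\<dots> \<le> mrank (four_block_mat P (0\<^sub>m m m) (0\<^sub>m m m) S)"
    by (rule mrank_mult_right[of _ "m + n" "m + m" _ "m + m"]) (auto intro!: carrier_matI simp: d)
  also have "\<dots> = i_plus N + mrank B"
    using mrank_block_diag[OF c(1) SC] rP rS by simp
  finally have r1: "mrank (C * P0) \<le> mrank B + i_plus N" by simp
  have QNQ: "Q\<^sup>H * N * Q \<in> carrier_mat m m" by (intro carrier_matI) (simp_all add: d)
  have r2: "mrank (Q0\<^sup>H * M0 * Q0) = mrank B + i_plus N"
    unfolding QMQ0 using mrank_block_diag[OF QNQ SC] rQ rS by simp
  have psd0: "pos_semidef (Q0\<^sup>H * M0 * Q0)"
  proof -
    obtain W where W: "W \<in> carrier_mat m m" "Q\<^sup>H * N * Q = W * W\<^sup>H"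
      using pos_semidef_factor[OF psd, of m] d by auto
    define V where "V = four_block_mat W (0\<^sub>m m m) (0\<^sub>m m m) S"
    have "Q0\<^sup>H * M0 * Q0 = V * V\<^sup>H"
      unfolding QMQ0 W(2) V_def using W(1) by (simp add: mat_simps d S)
    moreover have "V \<in> carrier_mat (m + m) (m + m)"
      using W(1) by (auto simp: V_def d intro!: carrier_matI)
    ultimately show ?thesis using pos_semidef_gram by simp
  qed
  have MH: "M \<in> hermitian_mats (m + n)"
    using AC by (auto simp: hermitian_mats_def M_def mat_simps d intro!: carrier_matI)
  have "i_plus M = mrank B + i_plus N"
    by (rule i_plus_eqI[OF MH _ _ _ MPG, of "m + m" "m + m" "C'\<^sup>H * Q0" "m + m"])
       (use psd0 r1 r2 in \<open>auto simp: QMQ intro!: carrier_matI\<close>)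
  then show ?thesis by (simp add: M_def N_def E_def)
qed

lemma uminus_mp: "(- B)\<^sup>\<dagger> = - B\<^sup>\<dagger>"
  by (rule mp_inverse_eqI) (auto simp: is_mp_inverse_def mat_simps intro!: carrier_matI)

lemma E_proj_uminus: "E_proj (- B) = E_proj B"
  by (simp add: E_proj_def uminus_mp mat_simps)

lemma mrank_uminus: "mrank (- B) = mrank B"
proof -
  have "complex_of_nat (mrank (- B)) = of_nat (mrank B)"
    unfolding mrank_mp by (simp add: uminus_mp mat_simps)
  then show ?thesis by (simp only: of_nat_eq_iff)
qed

text \<open>Negating the bordered matrix gives a bordered matrix for \<open>- A\<close> and \<open>- B\<close>.\<close>

lemma i_minus_bordered:
  assumes A: "A \<in> hermitian_mats m" and B: "B \<in> carrier_mat m n"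
  shows "i_minus (four_block_mat A B (B\<^sup>H) (0\<^sub>m n n)) = mrank B + i_plus (- (E_proj B * A * E_proj B))"
proof -
  have AC: "A \<in> carrier_mat m m" "A\<^sup>H = A" using A by (auto simp: hermitian_mats_def)
  note d = carrier_matD[OF AC(1)] carrier_matD[OF B]
  let ?M = "four_block_mat A B (B\<^sup>H) (0\<^sub>m n n)"
  have MH: "?M \<in> hermitian_mats (m + n)"
    using AC by (auto simp: hermitian_mats_def mat_simps d intro!: carrier_matI)
  have "- ?M = four_block_mat (- A) (- B) ((- B)\<^sup>H) (0\<^sub>m n n)"
    by (rule eq_matI) (auto simp: d)
  then have "i_minus ?M = i_plus (four_block_mat (- A) (- B) ((- B)\<^sup>H) (0\<^sub>m n n))"
    using i_minus_eq_i_plus_uminus[OF MH] by simp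
  also have "\<dots> = mrank (- B) + i_plus (E_proj (- B) * (- A) * E_proj (- B))"
    by (rule i_plus_bordered) (use uminus_hermitian[OF A] B in auto)
  also have "E_proj (- B) * (- A) * E_proj (- B) = - (E_proj B * A * E_proj B)"
    by (simp add: E_proj_uminus mat_simps d)
  finally show ?thesis by (simp only: mrank_uminus)
qed

section \<open>Positive definiteness\<close>

lemma pos_def_iff:
  assumes n: "dim_row P = n"
  shows "pos_def P \<longleftrightarrow> pos_semidef P \<and> mrank P = n"
proof
  assume P: "pos_def P"
  have PC: "P \<in> carrier_mat n n" using P n by (auto simp: pos_def_def hermitian_mats_def)
  have pos: "0 < (P *\<^sub>v v) \<bullet>c v" if "v \<in> carrier_vec n" "v \<noteq> 0\<^sub>v n" for v
    using P n that by (auto simp: pos_def_def)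
  have "0 \<le> (P *\<^sub>v v) \<bullet>c v" if v: "v \<in> carrier_vec n" for v
  proof (cases "v = 0\<^sub>v n")
    case True
    then show ?thesis using mult_mat_vec_carrier[OF PC v] by simp
  next
    case False
    then show ?thesis using pos[OF v] by simp
  qed
  then have psd: "pos_semidef P" using P n by (auto simp: pos_semidef_def pos_def_def)
  have "P\<^sup>\<dagger> * P = 1\<^sub>m n"
  proof (rule injective_left_inverse[OF PC])
    fix v assume "v \<in> carrier_vec n" "P *\<^sub>v v = 0\<^sub>v n"
    then show "v = 0\<^sub>v n" using pos[of v] by auto
  qed
  moreover have "P\<^sup>H = P" using pos_semidef_carrier[OF psd n] by simp
  ultimately have "P * P\<^sup>\<dagger> = 1\<^sub>m n" using mp_hermitian(2)[of P] by simp
  then show "pos_semidef P \<and> mrank P = n" using psd mrank_full_iff[OF PC] by simp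
next
  assume P: "pos_semidef P \<and> mrank P = n"
  have PC: "P \<in> carrier_mat n n" "P\<^sup>H = P" using pos_semidef_carrier P n by auto
  obtain W where W: "W \<in> carrier_mat n n" "P = W * W\<^sup>H"
    using pos_semidef_factor[of P n] P n by blast
  have PP: "P\<^sup>\<dagger> * P = 1\<^sub>m n"
    using mrank_full_iff[OF PC(1)] P mp_hermitian(2)[OF PC(2)] by simp
  have "0 < (P *\<^sub>v v) \<bullet>c v" if v: "v \<in> carrier_vec n" "v \<noteq> 0\<^sub>v n" for v
  proof -
    have u: "W\<^sup>H *\<^sub>v v \<in> carrier_vec n" using W v by (auto intro!: mult_mat_vec_carrier)
    have "W\<^sup>H *\<^sub>v v \<noteq> 0\<^sub>v n"
    proof
      assume "W\<^sup>H *\<^sub>v v = 0\<^sub>v n"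
      then have "P *\<^sub>v v = 0\<^sub>v n"
        unfolding W(2) using W v by (subst assoc_mult_mat_vec[of W n n _ n]) auto
      then have "(P\<^sup>\<dagger> * P) *\<^sub>v v = 0\<^sub>v n"
        using PC v by (subst assoc_mult_mat_vec[of "P\<^sup>\<dagger>" n n _ n]) auto
      then show False using v PP by simp
    qed
    then show ?thesis
      unfolding W(2) scalar_prod_gram[OF W(1) v(1)] using conjugate_square_greater_0_vec[OF u] by simp
  qed
  then show "pos_def P" using P n by (auto simp: pos_semidef_def pos_def_def)
qed

section \<open>The inequality \<open>B X B\<^sup>H \<succeq> A\<close>\<close>

text \<open>Let \<open>P = W W\<^sup>H\<close> and \<open>Q = W\<^sup>H E\<close>, so that \<open>N = Q\<^sup>H Q\<close> and \<open>P E = W Q\<close>. Cancelling \<open>Q\<^sup>H\<close> shows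
  \<open>Q = Q N\<^sup>\<dagger> N\<close>. The Schur complement is \<open>W K W\<^sup>H\<close>, where \<open>K = I - Q N\<^sup>\<dagger> Q\<^sup>H\<close> is the orthogonal projection
  onto the complement of the column space of \<open>Q\<close>.\<close>

lemma psd_schur_complement:
  assumes P: "pos_semidef P" "dim_row P = m" and E: "E \<in> carrier_mat m m" "E\<^sup>H = E"
  defines "N \<equiv> E * P * E"
  shows "N * N\<^sup>\<dagger> * (E * P) = E * P" "pos_semidef (P - P * E * N\<^sup>\<dagger> * E * P)"
    "P * E * N\<^sup>\<dagger> * N = P * E"
proof -
  obtain W where W: "W \<in> carrier_mat m m" "P = W * W\<^sup>H"
    using pos_semidef_factor[OF P] by blast
  define Q where "Q = W\<^sup>H * E"
  have Q: "Q \<in> carrier_mat m m" using W E by (auto simp: Q_def)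
  note d = carrier_matD[OF W(1)] carrier_matD[OF E(1)] carrier_matD[OF Q]
  have NQ: "N = Q\<^sup>H * Q" by (simp add: N_def W(2) Q_def mat_simps d E)
  have NH: "N\<^sup>H = N" by (simp add: NQ mat_simps d)
  have N: "N \<in> carrier_mat m m" by (intro carrier_matI) (simp_all add: NQ d)
  note d = d carrier_matD[OF N]
  define Z where "Z = 1\<^sub>m m - N\<^sup>\<dagger> * N"
  have Z: "Z \<in> carrier_mat m m" by (auto simp: Z_def d intro!: carrier_matI)
  note d = d carrier_matD[OF Z]
  have "N * Z = 0\<^sub>m m m" by (auto simp: Z_def mat_simps d)
  then have "Q\<^sup>H * (Q * Z) = 0\<^sub>m m m" by (simp add: NQ mat_simps d)
  then have QZ: "Q * Z = 0\<^sub>m m m" by (rule gram_cancel[OF Q Z])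
  then have "Q - Q * (N\<^sup>\<dagger> * N) = 0\<^sub>m m m" by (simp add: Z_def mat_simps d)
  then have QN: "Q = Q * (N\<^sup>\<dagger> * N)"
    by (subst (asm) minus_eq_zero_mat_iff) (use Q N in \<open>auto intro!: carrier_matI\<close>)
  have PE: "P * E = W * Q" by (simp add: W(2) Q_def mat_simps d)
  show PEN: "P * E * N\<^sup>\<dagger> * N = P * E"
    unfolding PE using QN by (simp add: mat_simps d)
  have PH: "P\<^sup>H = P" by (simp add: W(2) mat_simps d)
  have dP: "dim_row P = m" "dim_col P = m" by (simp_all add: W(2) d)
  show "N * N\<^sup>\<dagger> * (E * P) = E * P"
    using arg_cong[OF PEN, of mat_adjoint] by (simp add: mat_simps d dP PH E NH mp_hermitian(1)[OF NH])
  define K where "K = 1\<^sub>m m - Q * (N\<^sup>\<dagger> * Q\<^sup>H)"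
  have K: "K \<in> carrier_mat m m" by (auto simp: K_def d intro!: carrier_matI)
  have KH: "K\<^sup>H = K" by (simp add: K_def mat_simps d mp_hermitian(1)[OF NH])
  have "Q\<^sup>H * (Q * X) = N * X" if "dim_row X = m" for X
    using that by (simp add: NQ mat_simps d)
  then have KK: "K * K = K"
    by (auto simp: K_def mat_simps d intro!: eq_matI simp del: index_mult_mat(1))
  have EP: "E * P = Q\<^sup>H * W\<^sup>H" by (simp add: W(2) Q_def mat_simps d E)
  have "P - P * E * N\<^sup>\<dagger> * E * P = P - (P * E) * N\<^sup>\<dagger> * (E * P)"
    by (simp add: mat_simps d dP)
  also have "\<dots> = W * K * W\<^sup>H"
    unfolding PE EP by (simp add: K_def W(2) mat_simps d)
  also have "\<dots> = (W * K) * (W * K)\<^sup>H"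
    using KH mult_chain[OF KK, of "W\<^sup>H"] K by (simp add: mat_simps d)
  finally show "pos_semidef (P - P * E * N\<^sup>\<dagger> * E * P)"
    using pos_semidef_gram[of "W * K" m m] W K by simp
qed

locale hermitian_inequality =
  fixes A B :: "complex mat" and m n :: nat
  assumes A: "A \<in> hermitian_mats m" and B: "B \<in> carrier_mat m n"
begin

definition E :: "complex mat" where "E = E_proj B"
definition N :: "complex mat" where "N = E * A * E"
text \<open>A generalised Schur complement of \<open>N\<close> in \<open>A\<close>; when the inequality is solvable, it is the
  least matrix of the form \<open>B X B\<^sup>H\<close> above \<open>A\<close>.\<close>

definition S :: "complex mat" where "S = A - A * E * N\<^sup>\<dagger> * E * A"

lemma AC: "A \<in> carrier_mat m m" "A\<^sup>H = A"
  using A by (auto simp: hermitian_mats_def)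

lemma dims [simp]: "dim_row A = m" "dim_col A = m" "dim_row B = m" "dim_col B = n"
  "dim_row E = m" "dim_col E = m" "dim_row N = m" "dim_col N = m" "dim_row S = m" "dim_col S = m"
  using AC B by (auto simp: E_def N_def S_def)

lemma EC: "E \<in> carrier_mat m m" and NC: "N \<in> carrier_mat m m" and SC: "S \<in> carrier_mat m m"
  by (auto intro!: carrier_matI)

lemma E_simps: "E\<^sup>H = E" "E * E = E" "E * B = 0\<^sub>m m n" "B\<^sup>H * E = 0\<^sub>m n m"
  by (auto simp: E_def mat_simps)

lemma E_chain: "dim_row X = m \<Longrightarrow> E * (E * X) = E * X"
  "dim_row X = n \<Longrightarrow> E * (B * X) = 0\<^sub>m m (dim_col X)"
  "dim_row X = m \<Longrightarrow> B\<^sup>H * (E * X) = 0\<^sub>m n (dim_col X)"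
  by (simp_all add: mult_chain[OF E_simps(2)] mult_chain[OF E_simps(3)] mult_chain[OF E_simps(4)] mat_simps)

lemma NH: "N\<^sup>H = N" "(N\<^sup>\<dagger>)\<^sup>H = N\<^sup>\<dagger>" "N\<^sup>\<dagger> * N = N * N\<^sup>\<dagger>"
proof -
  show *: "N\<^sup>H = N" by (simp add: N_def mat_simps E_simps AC)
  show "(N\<^sup>\<dagger>)\<^sup>H = N\<^sup>\<dagger>" "N\<^sup>\<dagger> * N = N * N\<^sup>\<dagger>" using mp_hermitian[OF *] by auto
qed

text \<open>\<open>N = (E A) E\<close> has its column space inside that of \<open>E A\<close>, so equality of ranks means equality
  of column spaces.\<close>

lemma rank_condition_iff: "mrank N = mrank (E * A) \<longleftrightarrow> N * N\<^sup>\<dagger> * (E * A) = E * A"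
proof
  have EA: "E * A \<in> carrier_mat m m" using EC AC by auto
  have NEA: "N = (E * A) * E" by (simp add: N_def)
  have le: "mrank N \<le> mrank (E * A)"
    unfolding NEA by (rule mrank_mult_left[OF EA EC])
  {
    assume "N * N\<^sup>\<dagger> * (E * A) = E * A"
    from column_space_rank(1)[OF EA NC this] le show "mrank N = mrank (E * A)" by simp
  }
  assume r: "mrank N = mrank (E * A)"
  have "(E * A) * (E * A)\<^sup>\<dagger> * N = N"
    using arg_cong[OF mp_mult(1)[of "E * A"], of "\<lambda>M. M * E"] unfolding NEA
    by (simp add: mult_assoc_dim)
  from column_space_rank(2)[OF NC EA this r] show "N * N\<^sup>\<dagger> * (E * A) = E * A" .
qed

lemma residual_facts:
  assumes X: "X \<in> hermitian_mats n"
  defines "P \<equiv> B * X * B\<^sup>H - A"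
  shows "dim_row P = m" "dim_col P = m" "E * P * E = - N" "E * P = - (E * A)" "P * E = - (A * E)"
proof -
  have dX: "dim_row X = n" "dim_col X = n" using X by (auto simp: hermitian_mats_def)
  show "dim_row P = m" "dim_col P = m" by (auto simp: P_def)
  show "E * P = - (E * A)" "P * E = - (A * E)" "E * P * E = - N"
    by (auto simp: P_def N_def mat_simps dX E_simps E_chain)
qed

text \<open>The three conclusions are statements about the residual \<open>P = B X B\<^sup>H - A\<close>, whose compressions
  by \<open>E\<close> do not depend on \<open>X\<close>.\<close>

lemma solvable_necessary:
  assumes X: "X \<in> hermitian_mats n" and psd: "pos_semidef (B * X * B\<^sup>H - A)"
  shows "pos_semidef (- N)" "N * N\<^sup>\<dagger> * (E * A) = E * A" "pos_semidef (B * X * B\<^sup>H - S)"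
proof -
  define P where "P = B * X * B\<^sup>H - A"
  note r = residual_facts[OF X, folded P_def]
  note psd = psd[folded P_def]
  note sc = psd_schur_complement[OF psd r(1) EC E_simps(1), unfolded r(3) uminus_mp]
  show "pos_semidef (- N)"
    using pos_semidef_congruence[OF psd r(1) EC] r(3) by (simp add: E_simps)
  show "N * N\<^sup>\<dagger> * (E * A) = E * A"
    using sc(1) unfolding r(4) by (simp add: mat_simps)
  have "P - P * E * (- N\<^sup>\<dagger>) * E * P = P - (P * E) * (- N\<^sup>\<dagger>) * (E * P)"
    by (simp add: mat_simps r(1,2))
  also have "\<dots> = P + A * E * N\<^sup>\<dagger> * E * A"
    unfolding r(4,5) using r(1,2)
    by (auto simp: mat_simps intro!: eq_matI simp del: index_mult_mat(1))
  also have "\<dots> = B * X * B\<^sup>H - S"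
    unfolding P_def S_def by (auto intro!: eq_matI simp del: index_mult_mat(1))
  finally show "pos_semidef (B * X * B\<^sup>H - S)" using sc(2) by simp
qed

text \<open>\<open>S - A = C (- N) C\<^sup>H\<close> with \<open>C = A E N\<^sup>\<dagger>\<close>.\<close>

lemma S_minus_A_psd:
  assumes "pos_semidef (- N)"
  shows "pos_semidef (S - A)"
proof -
  let ?C = "A * E * N\<^sup>\<dagger>"
  have C: "?C \<in> carrier_mat m m" by (auto intro!: carrier_matI)
  have "?C * (- N) * ?C\<^sup>H = - (A * E * N\<^sup>\<dagger> * E * A)"
    by (simp add: mat_simps NH(1,2) AC E_simps)
  also have "\<dots> = S - A"
    unfolding S_def by (auto intro!: eq_matI simp del: index_mult_mat(1))
  finally show ?thesis using pos_semidef_congruence[OF assms _ C] by simp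
qed

lemma SH: "S\<^sup>H = S"
  by (simp add: S_def mat_simps NH AC E_simps)

text \<open>The rank condition amounts to \<open>E S = 0\<close>, that is, to the solvability of \<open>B X B\<^sup>H = S\<close>.\<close>

lemma S_absorb:
  assumes "N * N\<^sup>\<dagger> * (E * A) = E * A"
  shows "B * (B\<^sup>\<dagger> * S) = S"
proof -
  have "E * (A * (E * (N\<^sup>\<dagger> * (E * A)))) = E * A"
    using assms by (simp add: N_def mat_simps)
  then have "E * S = 0\<^sub>m m m" by (auto simp: S_def mat_simps intro!: eq_matI simp del: index_mult_mat(1))
  then have "S - B * (B\<^sup>\<dagger> * S) = 0\<^sub>m m m" by (simp add: E_def E_proj_def mat_simps)
  then show ?thesis
    by (subst (asm) minus_eq_zero_mat_iff) (auto intro!: carrier_matI)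
qed

lemma star_solution_eq:
  assumes "U \<in> carrier_mat n n" "V \<in> carrier_mat n n"
  shows "star_solution A B U V
    = B\<^sup>\<dagger> * S * (B\<^sup>\<dagger>)\<^sup>H + U * U\<^sup>H + F_proj B * V + V\<^sup>H * F_proj B"
  using assms by (simp add: star_solution_def S_def N_def E_def mat_simps)

lemma star_solution_hermitian:
  assumes "U \<in> carrier_mat n n" "V \<in> carrier_mat n n"
  shows "star_solution A B U V \<in> hermitian_mats n"
  unfolding star_solution_eq[OF assms] hermitian_mats_def
  using assms by (auto simp: mat_simps SH intro!: eq_matI carrier_matI simp del: index_mult_mat(1))

lemma star_solution_image:
  assumes c: "N * N\<^sup>\<dagger> * (E * A) = E * A" and U: "U \<in> carrier_mat n n" "V \<in> carrier_mat n n"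
  shows "B * star_solution A B U V * B\<^sup>H = S + B * U * U\<^sup>H * B\<^sup>H"
proof -
  have "B * (B\<^sup>\<dagger> * (S * ((B\<^sup>\<dagger>)\<^sup>H * B\<^sup>H))) = S * (B * B\<^sup>\<dagger>)"
    using arg_cong[OF S_absorb[OF c], of "\<lambda>M. M * (B * B\<^sup>\<dagger>)"] by (simp add: mat_simps)
  also have "\<dots> = S"
    using arg_cong[OF S_absorb[OF c], of mat_adjoint] by (simp add: mat_simps SH)
  finally have *: "B * (B\<^sup>\<dagger> * (S * (B * B\<^sup>\<dagger>))) = S" by (simp add: mat_simps)
  show ?thesis
    unfolding star_solution_eq[OF U] using U * by (simp add: mat_simps)
qed

text \<open>With \<open>T = B\<^sup>\<dagger> B\<close>, the block \<open>T Y T = B\<^sup>\<dagger> (B Y B\<^sup>H) (B\<^sup>\<dagger>)\<^sup>H\<close> is positive semidefinite and yields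
  \<open>U\<close>. The other blocks of \<open>Y\<close> with respect to \<open>T + F = I\<close> are absorbed by \<open>V\<close>.\<close>

lemma general_form:
  assumes Y: "Y \<in> hermitian_mats n" and psd: "pos_semidef (B * Y * B\<^sup>H)"
  shows "\<exists>U \<in> carrier_mat n n. \<exists>V \<in> carrier_mat n n.
    Y = U * U\<^sup>H + F_proj B * V + V\<^sup>H * F_proj B"
proof -
  have YC: "Y \<in> carrier_mat n n" "Y\<^sup>H = Y" using Y by (auto simp: hermitian_mats_def)
  note dY = carrier_matD[OF YC(1)]
  define T where "T = B\<^sup>\<dagger> * B"
  have T: "T\<^sup>H = T" "T * T = T" "dim_row T = n" "dim_col T = n" by (auto simp: T_def mat_simps)
  have BC: "B\<^sup>\<dagger> \<in> carrier_mat n m" using B by simp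
  have "pos_semidef (B\<^sup>\<dagger> * (B * Y * B\<^sup>H) * (B\<^sup>\<dagger>)\<^sup>H)"
    by (rule pos_semidef_congruence[OF psd _ BC]) simp
  moreover have "B\<^sup>\<dagger> * (B * Y * B\<^sup>H) * (B\<^sup>\<dagger>)\<^sup>H = T * (Y * T)"
    by (simp add: T_def mat_simps dY)
  ultimately obtain U where U: "U \<in> carrier_mat n n" "T * (Y * T) = U * U\<^sup>H"
    using pos_semidef_factor[of "T * (Y * T)" n] T by auto
  \<comment> \<open>The factor 1/2 because the block \<open>F Y F\<close> occurs in both \<open>F V\<close> and \<open>V\<^sup>H F\<close>.\<close>
  define V where "V = Y * T + (1/2) \<cdot>\<^sub>m (Y * F_proj B)"
  have V: "V \<in> carrier_mat n n" by (auto simp: V_def T dY intro!: carrier_matI)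
  have F: "F_proj B = 1\<^sub>m n - T" by (simp add: F_proj_def T_def)
  have "Y = T * (Y * T) + F_proj B * V + V\<^sup>H * F_proj B"
    unfolding V_def F using T dY YC
    by (auto simp: mat_simps mult_chain[OF T(2)] field_simps intro!: eq_matI simp del: index_mult_mat(1))
  then show ?thesis using U V by auto
qed

lemma solution_iff:
  "(\<exists>X \<in> hermitian_mats n. B * X * B\<^sup>H \<succeq>\<^sub>L A) \<longleftrightarrow>
    pos_semidef (- N) \<and> N * N\<^sup>\<dagger> * (E * A) = E * A"
proof
  assume "\<exists>X \<in> hermitian_mats n. B * X * B\<^sup>H \<succeq>\<^sub>L A"
  then show "pos_semidef (- N) \<and> N * N\<^sup>\<dagger> * (E * A) = E * A"
    using solvable_necessary by (auto simp: loewner_ge_def)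
next
  assume c: "pos_semidef (- N) \<and> N * N\<^sup>\<dagger> * (E * A) = E * A"
  have z: "0\<^sub>m n n \<in> carrier_mat n n" by simp
  have "B * star_solution A B (0\<^sub>m n n) (0\<^sub>m n n) * B\<^sup>H = S"
    using star_solution_image[OF _ z z] c by (simp add: mat_simps)
  then have "B * star_solution A B (0\<^sub>m n n) (0\<^sub>m n n) * B\<^sup>H \<succeq>\<^sub>L A"
    using S_minus_A_psd c by (simp add: loewner_ge_def)
  then show "\<exists>X \<in> hermitian_mats n. B * X * B\<^sup>H \<succeq>\<^sub>L A"
    using star_solution_hermitian[OF z z] by blast
qed

lemma star_solution_psd:
  assumes N: "pos_semidef (- N)" and c: "N * N\<^sup>\<dagger> * (E * A) = E * A"
    and U: "U \<in> carrier_mat n n" "V \<in> carrier_mat n n"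
  shows "B * star_solution A B U V * B\<^sup>H \<succeq>\<^sub>L A"
proof -
  have "B * star_solution A B U V * B\<^sup>H - A = (S - A) + (B * U) * (B * U)\<^sup>H"
    unfolding star_solution_image[OF c U]
    using U by (auto simp: mat_simps intro!: eq_matI simp del: index_mult_mat(1))
  moreover have "B * U \<in> carrier_mat m n" using B U by auto
  ultimately show ?thesis
    using pos_semidef_add[OF S_minus_A_psd[OF N] _ pos_semidef_gram, of m "B * U" m n]
    by (simp add: loewner_ge_def)
qed

lemma solution_set:
  assumes N: "pos_semidef (- N)" and c: "N * N\<^sup>\<dagger> * (E * A) = E * A"
  shows "{X \<in> hermitian_mats n. B * X * B\<^sup>H \<succeq>\<^sub>L A}
    = {star_solution A B U V | U V. U \<in> carrier_mat n n \<and> V \<in> carrier_mat n n}"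
proof (intro Set.equalityI subsetI)
  fix X assume "X \<in> {X \<in> hermitian_mats n. B * X * B\<^sup>H \<succeq>\<^sub>L A}"
  then have X: "X \<in> hermitian_mats n" "pos_semidef (B * X * B\<^sup>H - A)"
    by (auto simp: loewner_ge_def)
  have XC: "X \<in> carrier_mat n n" "X\<^sup>H = X" using X by (auto simp: hermitian_mats_def)
  note dX = carrier_matD[OF XC(1)]
  define X0 where "X0 = B\<^sup>\<dagger> * S * (B\<^sup>\<dagger>)\<^sup>H"
  have dX0: "dim_row X0 = n" "dim_col X0 = n" "X0\<^sup>H = X0" by (auto simp: X0_def mat_simps SH)
  have z: "0\<^sub>m n n \<in> carrier_mat n n" by simp
  have X0S: "B * X0 * B\<^sup>H = S"
    using star_solution_image[OF c z z] unfolding star_solution_eq[OF z z]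
    by (simp add: mat_simps X0_def)
  have "X - X0 \<in> hermitian_mats n"
    using XC dX0 dX by (auto simp: hermitian_mats_def mat_simps intro!: carrier_matI)
  moreover have "pos_semidef (B * (X - X0) * B\<^sup>H)"
    using solvable_necessary(3)[OF X] X0S by (simp add: mat_simps dX dX0)
  ultimately obtain U V where UV: "U \<in> carrier_mat n n" "V \<in> carrier_mat n n"
    and eq: "X - X0 = U * U\<^sup>H + F_proj B * V + V\<^sup>H * F_proj B"
    using general_form by blast
  have "X = X0 + (X - X0)" using dX dX0 by (auto intro!: eq_matI)
  also have "\<dots> = star_solution A B U V"
    unfolding star_solution_eq[OF UV] eq X0_def[symmetric] using UV dX0
    by (auto intro!: eq_matI simp del: index_mult_mat(1))
  finally show "X \<in> {star_solution A B U V | U V. U \<in> carrier_mat n n \<and> V \<in> carrier_mat n n}"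
    using UV by blast
next
  fix X assume "X \<in> {star_solution A B U V | U V. U \<in> carrier_mat n n \<and> V \<in> carrier_mat n n}"
  then show "X \<in> {X \<in> hermitian_mats n. B * X * B\<^sup>H \<succeq>\<^sub>L A}"
    using star_solution_hermitian star_solution_psd[OF N c] by auto
qed

lemma star_solution_residual:
  assumes c: "N * N\<^sup>\<dagger> * (E * A) = E * A" and U: "U \<in> carrier_mat n n" "V \<in> carrier_mat n n"
  shows "A - B * star_solution A B U V * B\<^sup>H = A * E * N\<^sup>\<dagger> * E * A - B * U * U\<^sup>H * B\<^sup>H"
  unfolding star_solution_image[OF c U] S_def
  using U by (auto intro!: eq_matI simp del: index_mult_mat(1))

lemma inertia_condition_iff:
  "i_plus (four_block_mat A B (B\<^sup>H) (0\<^sub>m n n)) = mrank B \<and>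
   i_minus (four_block_mat A B (B\<^sup>H) (0\<^sub>m n n)) = mrank (row_block A B) \<longleftrightarrow>
   pos_semidef (- N) \<and> mrank N = mrank (E * A)"
proof -
  have NN: "N \<in> hermitian_mats m" using NC NH by (simp add: hermitian_mats_def)
  have "i_plus (four_block_mat A B (B\<^sup>H) (0\<^sub>m n n)) = mrank B \<longleftrightarrow> pos_semidef (- N)"
    using i_plus_bordered[OF A B] i_plus_eq_0_iff[OF NN] by (simp add: N_def E_def)
  moreover have "i_minus (four_block_mat A B (B\<^sup>H) (0\<^sub>m n n)) = mrank (row_block A B)
      \<longleftrightarrow> mrank N = mrank (E * A)" if "pos_semidef (- N)"
  proof -
    have "i_plus (- N) = mrank N"
      using i_plus_psd[OF that, of m] mrank_uminus[of N] by simp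
    then show ?thesis
      using i_minus_bordered[OF A B] mrank_row_block[OF AC(1) B] by (simp add: N_def E_def)
  qed
  ultimately show ?thesis by blast
qed

lemma strict_rank_condition_iff: "mrank N = mrank E \<longleftrightarrow> N * N\<^sup>\<dagger> * E = E"
proof
  have NEA: "N = E * (A * E)" by (simp add: N_def mat_simps)
  have le: "mrank N \<le> mrank E"
    unfolding NEA by (rule mrank_mult_left[OF EC, of _ m]) (auto intro!: carrier_matI)
  {
    assume "N * N\<^sup>\<dagger> * E = E"
    from column_space_rank(1)[OF EC NC this] le show "mrank N = mrank E" by simp
  }
  assume r: "mrank N = mrank E"
  have "E * E\<^sup>\<dagger> * N = N"
    unfolding NEA by (simp add: mat_simps)
  from column_space_rank(2)[OF NC EC this r] show "N * N\<^sup>\<dagger> * E = E" .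
qed

text \<open>An invertible \<open>P\<close> can be cancelled from the Schur complement identity \<open>P E N\<^sup>\<dagger> N = P E\<close>.\<close>

lemma strict_solvable_necessary:
  assumes X: "X \<in> hermitian_mats n" and pd: "pos_def (B * X * B\<^sup>H - A)"
  shows "N * N\<^sup>\<dagger> * E = E"
proof -
  define P where "P = B * X * B\<^sup>H - A"
  note r = residual_facts[OF X, folded P_def]
  have P: "pos_semidef P" "mrank P = m" using pd pos_def_iff[OF r(1)] by (auto simp: P_def)
  have PC: "P \<in> carrier_mat m m" "P\<^sup>H = P" using pos_semidef_carrier[OF P(1) r(1)] by auto
  have PP: "P\<^sup>\<dagger> * P = 1\<^sub>m m"
    using mrank_full_iff[OF PC(1)] P(2) mp_hermitian(2)[OF PC(2)] by simp
  have "P * E * (- N)\<^sup>\<dagger> * (- N) = P * E"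
    using psd_schur_complement(3)[OF P(1) r(1) EC E_simps(1)] unfolding r(3) .
  then have "P * (E * (N\<^sup>\<dagger> * N)) = P * E" by (simp add: uminus_mp mat_simps r(1,2))
  from arg_cong[OF this, of "\<lambda>M. P\<^sup>\<dagger> * M"] have "E * (N\<^sup>\<dagger> * N) = E"
    by (simp add: mult_chain[OF PP] r(1,2) mat_simps)
  from arg_cong[OF this, of mat_adjoint] show ?thesis
    by (simp add: mat_simps E_simps NH)
qed

text \<open>The witness has \<open>U = I\<close>. Its residual is \<open>D = (S - A) + B B\<^sup>H\<close>. If \<open>D Z = 0\<close>, then both summands
  annihilate \<open>Z\<close>. The second gives \<open>E Z = Z\<close>, and then the first gives \<open>N Z = 0\<close>; so
  \<open>Z = E Z = E N\<^sup>\<dagger> N Z = 0\<close>.\<close>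

lemma strict_solution_exists:
  assumes N: "pos_semidef (- N)" and NE: "N * N\<^sup>\<dagger> * E = E"
  shows "\<exists>X \<in> hermitian_mats n. B * X * B\<^sup>H \<succ>\<^sub>L A"
proof -
  have c: "N * N\<^sup>\<dagger> * (E * A) = E * A"
    using arg_cong[OF NE, of "\<lambda>M. M * A"] by (simp add: mat_simps)
  have one: "1\<^sub>m n \<in> carrier_mat n n" and z: "0\<^sub>m n n \<in> carrier_mat n n" by auto
  define D where "D = B * star_solution A B (1\<^sub>m n) (0\<^sub>m n n) * B\<^sup>H - A"
  have Dpsd: "pos_semidef D"
    using star_solution_psd[OF N c one z] by (simp add: D_def loewner_ge_def)
  have dD: "dim_row D = m" "dim_col D = m" by (auto simp: D_def)
  have DC: "D \<in> carrier_mat m m" "D\<^sup>H = D" using pos_semidef_carrier[OF Dpsd dD(1)] by auto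
  obtain G where G: "G \<in> carrier_mat m m" "- N = G * G\<^sup>H"
    using pos_semidef_factor[OF N, of m] by auto
  note dG = carrier_matD[OF G(1)]
  define K where "K = A * E * N\<^sup>\<dagger> * G"
  have K: "K \<in> carrier_mat m m" by (auto simp: K_def dG intro!: carrier_matI)
  have "K * K\<^sup>H = A * E * N\<^sup>\<dagger> * (G * G\<^sup>H) * N\<^sup>\<dagger> * E * A"
    by (simp add: K_def mat_simps dG NH AC E_simps)
  also have "\<dots> = - (A * E * N\<^sup>\<dagger> * E * A)"
    unfolding G(2)[symmetric] by (simp add: mat_simps)
  finally have KK: "K * K\<^sup>H = - (A * E * N\<^sup>\<dagger> * E * A)" .
  have D: "D = K * K\<^sup>H + B * B\<^sup>H"
    unfolding D_def star_solution_image[OF c one z] KK S_def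
    by (auto simp: mat_simps intro!: eq_matI simp del: index_mult_mat(1))
  define Z where "Z = 1\<^sub>m m - D\<^sup>\<dagger> * D"
  have Z: "Z \<in> carrier_mat m m" by (auto simp: Z_def dD intro!: carrier_matI)
  note dZ = carrier_matD[OF Z] carrier_matD[OF K]
  have "D * Z = 0\<^sub>m m m" by (auto simp: Z_def mat_simps dD)
  then have "Z\<^sup>H * (D * Z) = 0\<^sub>m m m" by (simp add: mat_simps dZ)
  then have s: "(K\<^sup>H * Z)\<^sup>H * (K\<^sup>H * Z) + (B\<^sup>H * Z)\<^sup>H * (B\<^sup>H * Z) = 0\<^sub>m m m"
    by (simp add: D mat_simps dZ)
  then have s': "(B\<^sup>H * Z)\<^sup>H * (B\<^sup>H * Z) + (K\<^sup>H * Z)\<^sup>H * (K\<^sup>H * Z) = 0\<^sub>m m m"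
    by (subst comm_add_mat[of _ m m]) ((intro carrier_matI; simp add: dZ)+, rule s)
  have KZ: "K\<^sup>H * Z = 0\<^sub>m m m" by (rule gram_sum_eq_zero[OF _ _ s, of m n]) (intro carrier_matI; simp add: dZ)+
  have BZ: "B\<^sup>H * Z = 0\<^sub>m n m" by (rule gram_sum_eq_zero[OF _ _ s', of n m]) (intro carrier_matI; simp add: dZ)+
  have EZ: "E * Z = Z"
  proof -
    have "E = 1\<^sub>m m - (B\<^sup>\<dagger>)\<^sup>H * B\<^sup>H" by (simp add: E_def E_proj_def mat_simps)
    then have "E * Z = Z - (B\<^sup>\<dagger>)\<^sup>H * (B\<^sup>H * Z)" by (simp add: mat_simps dZ)
    then show ?thesis by (simp add: BZ mat_simps dZ)
  qed
  have "K\<^sup>H * Z = G\<^sup>H * (N\<^sup>\<dagger> * (E * (A * (E * Z))))"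
    unfolding EZ by (simp add: K_def mat_simps dZ dG NH AC E_simps)
  also have "\<dots> = G\<^sup>H * (N\<^sup>\<dagger> * (N * Z))" by (simp add: N_def mat_simps dZ dG)
  finally have "G\<^sup>H * (N\<^sup>\<dagger> * (N * Z)) = 0\<^sub>m m m" unfolding KZ ..
  from arg_cong[OF this, of "\<lambda>M. G * M"] have "G * (G\<^sup>H * (N\<^sup>\<dagger> * (N * Z))) = 0\<^sub>m m m"
    by (simp add: mat_simps dG)
  then have "(G * G\<^sup>H) * (N\<^sup>\<dagger> * (N * Z)) = 0\<^sub>m m m" by (simp add: mat_simps dG dZ)
  then have "- (N * Z) = 0\<^sub>m m m" unfolding G(2)[symmetric] by (simp add: mat_simps dZ)
  from arg_cong[OF this, of uminus] have NZ: "N * Z = 0\<^sub>m m m" by auto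
  have EN: "E * (N\<^sup>\<dagger> * N) = E"
    using arg_cong[OF NE, of mat_adjoint] by (simp add: mat_simps E_simps NH)
  have "E * Z = E * (N\<^sup>\<dagger> * (N * Z))"
    using mult_chain[OF EN, of Z] by (simp add: mat_simps dZ)
  then have "Z = 0\<^sub>m m m" unfolding NZ EZ by (simp add: mat_simps)
  then have "1\<^sub>m m = D\<^sup>\<dagger> * D"
    unfolding Z_def by (subst (asm) minus_eq_zero_mat_iff) (auto simp: dD intro!: carrier_matI)
  then have "mrank D = m" using mrank_full_iff[OF DC(1)] mp_hermitian(2)[OF DC(2)] by simp
  then have "pos_def D" using Dpsd pos_def_iff[OF dD(1)] by simp
  then show ?thesis
    using star_solution_hermitian[OF one z] by (auto simp: D_def loewner_gt_def)
qed

lemma strict_solution_iff: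
  "(\<exists>X \<in> hermitian_mats n. B * X * B\<^sup>H \<succ>\<^sub>L A) \<longleftrightarrow> pos_semidef (- N) \<and> mrank N = mrank E"
proof
  assume "\<exists>X \<in> hermitian_mats n. B * X * B\<^sup>H \<succ>\<^sub>L A"
  then obtain X where X: "X \<in> hermitian_mats n" "pos_def (B * X * B\<^sup>H - A)"
    by (auto simp: loewner_gt_def)
  then have "pos_semidef (B * X * B\<^sup>H - A)" using pos_def_iff[OF refl] by blast
  then show "pos_semidef (- N) \<and> mrank N = mrank E"
    using solvable_necessary(1)[OF X(1)] strict_solvable_necessary[OF X] strict_rank_condition_iff
    by simp
next
  assume "pos_semidef (- N) \<and> mrank N = mrank E"
  then show "\<exists>X \<in> hermitian_mats n. B * X * B\<^sup>H \<succ>\<^sub>L A"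
    using strict_solution_exists strict_rank_condition_iff by blast
qed

text \<open>Among the solutions of the weak inequality, the strict ones are those whose residual has
  full rank.\<close>

lemma strict_solution_set:
  assumes N: "pos_semidef (- N)" and c: "N * N\<^sup>\<dagger> * (E * A) = E * A"
  shows "{X \<in> hermitian_mats n. B * X * B\<^sup>H \<succ>\<^sub>L A}
    = {star_solution A B U V | U V. U \<in> carrier_mat n n \<and> V \<in> carrier_mat n n \<and>
        mrank (A * E * N\<^sup>\<dagger> * E * A - B * U * U\<^sup>H * B\<^sup>H) = m}"
proof -
  have pd: "B * X * B\<^sup>H \<succ>\<^sub>L A \<longleftrightarrow> B * X * B\<^sup>H \<succeq>\<^sub>L A \<and> mrank (A - B * X * B\<^sup>H) = m" for X
  proof -
    have "A - B * X * B\<^sup>H = - (B * X * B\<^sup>H - A)" by (auto intro!: eq_matI simp del: index_mult_mat(1))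
    then have "mrank (A - B * X * B\<^sup>H) = mrank (B * X * B\<^sup>H - A)" using mrank_uminus by metis
    then show ?thesis unfolding loewner_gt_def loewner_ge_def by (subst pos_def_iff[of _ m]) auto
  qed
  show ?thesis
  proof (intro Set.equalityI subsetI)
    fix X assume "X \<in> {X \<in> hermitian_mats n. B * X * B\<^sup>H \<succ>\<^sub>L A}"
    then have X: "X \<in> {X \<in> hermitian_mats n. B * X * B\<^sup>H \<succeq>\<^sub>L A}" "mrank (A - B * X * B\<^sup>H) = m"
      unfolding pd by auto
    then obtain U V where UV: "U \<in> carrier_mat n n" "V \<in> carrier_mat n n" "X = star_solution A B U V"
      unfolding solution_set[OF N c] by blast
    then show "X \<in> {star_solution A B U V | U V. U \<in> carrier_mat n n \<and> V \<in> carrier_mat n n \<and>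
        mrank (A * E * N\<^sup>\<dagger> * E * A - B * U * U\<^sup>H * B\<^sup>H) = m}"
      using X(2) star_solution_residual[OF c UV(1,2)] by auto
  next
    fix X assume "X \<in> {star_solution A B U V | U V. U \<in> carrier_mat n n \<and> V \<in> carrier_mat n n \<and>
        mrank (A * E * N\<^sup>\<dagger> * E * A - B * U * U\<^sup>H * B\<^sup>H) = m}"
    then obtain U V where UV: "U \<in> carrier_mat n n" "V \<in> carrier_mat n n" "X = star_solution A B U V"
      "mrank (A * E * N\<^sup>\<dagger> * E * A - B * U * U\<^sup>H * B\<^sup>H) = m"
      by blast
    then show "X \<in> {X \<in> hermitian_mats n. B * X * B\<^sup>H \<succ>\<^sub>L A}"
      unfolding pd using star_solution_psd[OF N c UV(1,2)] star_solution_hermitian[OF UV(1,2)]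
        star_solution_residual[OF c UV(1,2)] by auto
  qed
qed

lemma consistent_facts:
  assumes "\<exists>X \<in> hermitian_mats n. B * X * B\<^sup>H = A"
  shows "E * A = 0\<^sub>m m m" "A * E = 0\<^sub>m m m" "N = 0\<^sub>m m m" "S = A" "pos_semidef (- N)"
    "N * N\<^sup>\<dagger> * (E * A) = E * A"
proof -
  obtain X where X: "X \<in> carrier_mat n n" "A = B * X * B\<^sup>H"
    using assms by (auto simp: hermitian_mats_def)
  show EA: "E * A = 0\<^sub>m m m"
    unfolding X(2) using X(1) by (simp add: mat_simps E_chain)
  show AE: "A * E = 0\<^sub>m m m"
    using arg_cong[OF EA, of mat_adjoint] by (simp add: mat_simps AC E_simps)
  show N0: "N = 0\<^sub>m m m" by (simp add: N_def EA mat_simps)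
  show "S = A" by (auto simp: S_def AE mat_simps)
  have "- N = 0\<^sub>m m m * (0\<^sub>m m m)\<^sup>H" unfolding N0 by (auto simp: mat_simps)
  then show "pos_semidef (- N)" using pos_semidef_gram[of "0\<^sub>m m m" m m] by simp
  show "N * N\<^sup>\<dagger> * (E * A) = E * A" by (simp add: EA N0 mp_zero mat_simps)
qed

text \<open>Here \<open>N = 0\<close>, so the strict rank condition becomes \<open>E = 0\<close>: the columns of \<open>B\<close> span the
  whole space.\<close>

lemma consistent_strict_iff:
  assumes cons: "\<exists>X \<in> hermitian_mats n. B * X * B\<^sup>H = A"
  shows "(\<exists>X \<in> hermitian_mats n. B * X * B\<^sup>H \<succ>\<^sub>L A) \<longleftrightarrow> mrank B = m"
proof -
  note c = consistent_facts[OF cons]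
  have "(\<exists>X \<in> hermitian_mats n. B * X * B\<^sup>H \<succ>\<^sub>L A) \<longleftrightarrow> mrank E = 0"
    unfolding strict_solution_iff using c(3,5) by (auto simp: vec_space.rank_0I)
  also have "\<dots> \<longleftrightarrow> E = 0\<^sub>m m m"
    using mrank_eq_0[OF EC] by (auto simp: vec_space.rank_0I)
  also have "\<dots> \<longleftrightarrow> 1\<^sub>m m = B * B\<^sup>\<dagger>"
    unfolding E_def E_proj_def dims
    by (rule minus_eq_zero_mat_iff) (auto intro!: carrier_matI)
  also have "\<dots> \<longleftrightarrow> mrank B = m" using mrank_full_iff[OF B] by auto
  finally show ?thesis .
qed

text \<open>Now \<open>B X\<^sub>0 B\<^sup>H = A\<close> for \<open>X\<^sub>0 = B\<^sup>\<dagger> A (B\<^sup>\<dagger>)\<^sup>H\<close>, so a solution \<open>X\<close> is represented by \<open>U = X - X\<^sub>0\<close> and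
  \<open>V = 0\<close>.\<close>

lemma consistent_strict_solution_set:
  assumes cons: "\<exists>X \<in> hermitian_mats n. B * X * B\<^sup>H = A"
  shows "{X \<in> hermitian_mats n. B * X * B\<^sup>H \<succ>\<^sub>L A} =
    {B\<^sup>\<dagger> * A * (B\<^sup>\<dagger>)\<^sup>H + U + F_proj B * V + V\<^sup>H * F_proj B | U V.
      U \<in> hermitian_mats n \<and> B * U * B\<^sup>H \<succ>\<^sub>L 0\<^sub>m m m \<and> V \<in> carrier_mat n n}"
proof (intro Set.equalityI subsetI)
  note c = consistent_facts[OF cons]
  define X0 where "X0 = B\<^sup>\<dagger> * A * (B\<^sup>\<dagger>)\<^sup>H"
  have dX0: "dim_row X0 = n" "dim_col X0 = n" "X0\<^sup>H = X0" by (auto simp: X0_def mat_simps AC)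
  have z: "0\<^sub>m n n \<in> carrier_mat n n" by simp
  have X0A: "B * X0 * B\<^sup>H = A"
    using star_solution_image[OF c(6) z z] unfolding star_solution_eq[OF z z] c(4)
    by (simp add: mat_simps X0_def)
  {
    fix X assume "X \<in> {X \<in> hermitian_mats n. B * X * B\<^sup>H \<succ>\<^sub>L A}"
    then have X: "X \<in> carrier_mat n n" "X\<^sup>H = X" "pos_def (B * X * B\<^sup>H - A)"
      by (auto simp: hermitian_mats_def loewner_gt_def)
    note dX = carrier_matD[OF X(1)]
    have 1: "X - X0 \<in> hermitian_mats n"
      using X dX0 dX by (auto simp: hermitian_mats_def mat_simps intro!: carrier_matI)
    have "B * (X - X0) * B\<^sup>H - 0\<^sub>m m m = B * X * B\<^sup>H - A"
      using X0A by (simp add: mat_simps dX dX0)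
    then have 2: "B * (X - X0) * B\<^sup>H \<succ>\<^sub>L 0\<^sub>m m m" using X(3) by (simp add: loewner_gt_def)
    have "X = X0 + (X - X0) + F_proj B * 0\<^sub>m n n + (0\<^sub>m n n)\<^sup>H * F_proj B"
      using dX dX0 by (auto simp: mat_simps intro!: eq_matI)
    then show "X \<in> {B\<^sup>\<dagger> * A * (B\<^sup>\<dagger>)\<^sup>H + U + F_proj B * V + V\<^sup>H * F_proj B | U V.
      U \<in> hermitian_mats n \<and> B * U * B\<^sup>H \<succ>\<^sub>L 0\<^sub>m m m \<and> V \<in> carrier_mat n n}"
      unfolding X0_def[symmetric] using 1 2 z by blast
  }
  fix X assume "X \<in> {B\<^sup>\<dagger> * A * (B\<^sup>\<dagger>)\<^sup>H + U + F_proj B * V + V\<^sup>H * F_proj B | U V.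
      U \<in> hermitian_mats n \<and> B * U * B\<^sup>H \<succ>\<^sub>L 0\<^sub>m m m \<and> V \<in> carrier_mat n n}"
  then obtain U V where U: "U \<in> carrier_mat n n" "U\<^sup>H = U" and V: "V \<in> carrier_mat n n"
    and pd: "pos_def (B * U * B\<^sup>H - 0\<^sub>m m m)"
    and X: "X = X0 + U + F_proj B * V + V\<^sup>H * F_proj B"
    unfolding X0_def by (auto simp: hermitian_mats_def loewner_gt_def)
  note dU = carrier_matD[OF U(1)] carrier_matD[OF V]
  have "X \<in> hermitian_mats n"
    unfolding X hermitian_mats_def using U dU dX0
    by (auto simp: mat_simps intro!: eq_matI carrier_matI simp del: index_mult_mat(1))
  moreover have "B * X * B\<^sup>H = B * X0 * B\<^sup>H + B * U * B\<^sup>H"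
    unfolding X by (simp add: mat_simps dU dX0)
  then have "B * X * B\<^sup>H - A = B * U * B\<^sup>H - 0\<^sub>m m m"
    unfolding X0A by (auto intro!: eq_matI simp del: index_mult_mat(1))
  ultimately show "X \<in> {X \<in> hermitian_mats n. B * X * B\<^sup>H \<succ>\<^sub>L A}"
    using pd by (simp add: loewner_gt_def)
qed

end

theorem theorem2p2:
  fixes A B :: "complex mat" and m n :: nat
  assumes A: "A \<in> hermitian_mats m"
    and B: "B \<in> carrier_mat m n"
  shows
    "\<comment> \<open>(a)\<close>
     ((\<exists>X \<in> hermitian_mats n. B * X * B\<^sup>H \<succeq>\<^sub>L A) \<longleftrightarrow>
        E_proj B * A * E_proj B \<preceq>\<^sub>L 0\<^sub>m m m \<and>
        mrank (E_proj B * A * E_proj B) = mrank (E_proj B * A))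
     \<and> ((\<exists>X \<in> hermitian_mats n. B * X * B\<^sup>H \<succeq>\<^sub>L A) \<longleftrightarrow>
        i_plus (four_block_mat A B (B\<^sup>H) (0\<^sub>m n n)) = mrank B \<and>
        i_minus (four_block_mat A B (B\<^sup>H) (0\<^sub>m n n)) = mrank (row_block A B))
     \<and> ((\<exists>X \<in> hermitian_mats n. B * X * B\<^sup>H \<succeq>\<^sub>L A) \<longrightarrow>
        {X \<in> hermitian_mats n. B * X * B\<^sup>H \<succeq>\<^sub>L A} =
          {star_solution A B U V | U V. U \<in> carrier_mat n n \<and> V \<in> carrier_mat n n} \<and>
        (\<forall>U \<in> carrier_mat n n. \<forall>V \<in> carrier_mat n n.
          B * star_solution A B U V * B\<^sup>H =
            A - A * E_proj B * (E_proj B * A * E_proj B)\<^sup>\<dagger> * E_proj B * A + B * U * U\<^sup>H * B\<^sup>H \<and>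
          A - B * star_solution A B U V * B\<^sup>H =
            A * E_proj B * (E_proj B * A * E_proj B)\<^sup>\<dagger> * E_proj B * A - B * U * U\<^sup>H * B\<^sup>H))
     \<and> \<comment> \<open>(b)\<close>
     ((\<exists>X \<in> hermitian_mats n. B * X * B\<^sup>H \<succ>\<^sub>L A) \<longleftrightarrow>
        E_proj B * A * E_proj B \<preceq>\<^sub>L 0\<^sub>m m m \<and>
        mrank (E_proj B * A * E_proj B) = mrank (E_proj B))
     \<and> ((\<exists>X \<in> hermitian_mats n. B * X * B\<^sup>H \<succ>\<^sub>L A) \<longrightarrow>
        {X \<in> hermitian_mats n. B * X * B\<^sup>H \<succ>\<^sub>L A} =
          {star_solution A B U V | U V. U \<in> carrier_mat n n \<and> V \<in> carrier_mat n n \<and>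
             mrank (A * E_proj B * (E_proj B * A * E_proj B)\<^sup>\<dagger> * E_proj B * A
                    - B * U * U\<^sup>H * B\<^sup>H) = m})
     \<and> \<comment> \<open>(c)\<close>
     ((\<exists>X \<in> hermitian_mats n. B * X * B\<^sup>H = A) \<longrightarrow>
        {X \<in> hermitian_mats n. B * X * B\<^sup>H \<succeq>\<^sub>L A} =
          {B\<^sup>\<dagger> * A * (B\<^sup>\<dagger>)\<^sup>H + U * U\<^sup>H + F_proj B * V + V\<^sup>H * F_proj B | U V.
             U \<in> carrier_mat n n \<and> V \<in> carrier_mat n n})
     \<and> \<comment> \<open>(d)\<close>
     ((\<exists>X \<in> hermitian_mats n. B * X * B\<^sup>H = A) \<longrightarrow>
        ((\<exists>X \<in> hermitian_mats n. B * X * B\<^sup>H \<succ>\<^sub>L A) \<longleftrightarrow> mrank B = m) \<and>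
        ((\<exists>X \<in> hermitian_mats n. B * X * B\<^sup>H \<succ>\<^sub>L A) \<longrightarrow>
          {X \<in> hermitian_mats n. B * X * B\<^sup>H \<succ>\<^sub>L A} =
            {B\<^sup>\<dagger> * A * (B\<^sup>\<dagger>)\<^sup>H + U + F_proj B * V + V\<^sup>H * F_proj B | U V.
               U \<in> hermitian_mats n \<and> B * U * B\<^sup>H \<succ>\<^sub>L 0\<^sub>m m m \<and> V \<in> carrier_mat n n}))"
proof -
  interpret hermitian_inequality A B m n by unfold_locales (rule A, rule B)
  have N: "N = E_proj B * A * E_proj B" by (simp add: N_def E_def)
  have le: "E_proj B * A * E_proj B \<preceq>\<^sub>L 0\<^sub>m m m \<longleftrightarrow> pos_semidef (- N)"
    by (simp add: loewner_ge_def N mat_simps)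
  show ?thesis
  proof (intro conjI impI, goal_cases)
    case 1
    show ?case unfolding le solution_iff unfolding E_def[symmetric] N_def[symmetric] rank_condition_iff ..
  next
    case 2
    show ?case unfolding inertia_condition_iff solution_iff rank_condition_iff ..
  next
    case 3
    then show ?case unfolding solution_iff using solution_set by blast
  next
    case 4
    then have c: "N * N\<^sup>\<dagger> * (E * A) = E * A" unfolding solution_iff ..
    show ?case
      unfolding E_def[symmetric] N_def[symmetric] S_def[symmetric]
      using star_solution_image[OF c] star_solution_residual[OF c] by blast
  next
    case 5
    show ?case unfolding le strict_solution_iff unfolding E_def[symmetric] N_def[symmetric] ..
  next
    case 6
    then have s: "pos_semidef (- N)" "N * N\<^sup>\<dagger> * E = E"
      unfolding strict_solution_iff strict_rank_condition_iff by auto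
    have c: "N * N\<^sup>\<dagger> * (E * A) = E * A"
      using arg_cong[OF s(2), of "\<lambda>M. M * A"] by (simp add: mat_simps)
    show ?case
      using strict_solution_set[OF s(1) c] unfolding E_def[symmetric] N_def[symmetric] .
  next
    case 7
    note c = consistent_facts[OF 7]
    show ?case
      unfolding solution_set[OF c(5,6)]
      by (intro Collect_cong ex_cong1) (auto simp: star_solution_eq c(4))
  next
    case 8
    then show ?case by (rule consistent_strict_iff)
  next
    case 9
    then show ?case by (intro consistent_strict_solution_set)
  qed
qed

end
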